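(* Let $\Sigma=\{1,2,3\}$, and let $\overline\Gamma=\langle a,s\rangle$ be the group of automorphisms of the rooted tree $\Sigma^*$ generated by the rooted automorphism $a$, $a(\sigma_1\sigma_2\cdots\sigma_n)=(\sigma_1+1)\sigma_2\cdots\sigma_n$ (addition modulo $3$), and the automorphism $s$ fixing the first level and defined recursively by $\psi(s)=(a,a,s)$. Let $x=sa^{-1}$, $y=a^{-1}s$ and $K=\langle x,y\rangle\le\overline\Gamma$. Then the groups $K$ and $\overline\Gamma$ are not branch groups, but both are finitely $L$-presented.
   Context: The $3$-regular rooted tree is the free monoid $\Sigma^*$; a tree automorphism is a prefix-preserving bijection of $\Sigma^*$. For an automorphism $g$ fixing every vertex of the first level $\Sigma$, $\psi(g)=(g_1,g_2,g_3)$ where $g_i\in\operatorname{Aut}(\Sigma^* )$ is the restriction of $g$ to the subtree $i\Sigma^*$, identified with $\Sigma^*$ by deleting the prefix $i$. Thus $s$ acts as $a$ on the subtrees $1\Sigma^*$ and $2\Sigma^*$, and as $s$ on $3\Sigma^*$. For $G\le\operatorname{Aut}(\Sigma^* )$, let $\operatorname{Stab}_G(\tau)$ be the stabilizer of the vertex $\tau$, $\operatorname{Rist}_G(\sigma)=\bigcap_{\tau\notin\sigma\Sigma^*}\operatorname{Stab}_G(\tau)$ and $\operatorname{Rist}_G(n)=\prod_{\sigma\in\Sigma^n}\operatorname{Rist}_G(\sigma)$. $G$ (with its given action on $\Sigma^*$) is a branch group if it acts transitively on $\Sigma^n$ for every $n$ and $\operatorname{Rist}_G(n)$ has finite index in $G$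 for all $n$. An $L$-presentation is an expression $\langle S\,|\,Q\,|\,\Phi\,|\,R\rangle$ where $S$ is a set of symbols, $Q,R\subset F_S$ are sets of reduced words in the free group $F_S$ on $S$, and $\Phi$ is a set of group endomorphisms of $F_S$. It defines the group $F_S/\langle Q\cup\bigcup_{\phi\in\Phi^*}\phi(R)\rangle^\#$, where $\langle\cdot\rangle^\#$ is normal closure and $\Phi^*$ is the monoid generated by $\Phi$ under composition (including the identity). It is finite if $S,Q,\Phi,R$ are all finite. A group is finitely $L$-presented if it is isomorphic to the group defined by some finite $L$-presentation. *)

theory Defs
  imports
    "HOL-Algebra.Generated_Groups"
    "HOL-Library.Sublist"
    "HOL-Library.Numeral_Type"
begin

section \<open>Automorphisms of regular rooted trees\<close>

text \<open>
  The vertices of the regular rooted tree over a finite alphabet are the words over that alphabet,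
  i.e. lists; the subtree below a vertex \<open>\<sigma>\<close> consists of the words with prefix \<open>\<sigma>\<close>.
  Automorphisms act on the left, so the product is composition of functions.
\<close>

definition tree_aut :: "('a::finite list \<Rightarrow> 'a list) monoid" where
  "tree_aut =
    \<lparr>carrier = {g. bij g \<and> (\<forall>\<sigma> \<tau>. prefix \<sigma> \<tau> \<longrightarrow> prefix (g \<sigma>) (g \<tau>))},
     mult = (\<circ>), one = id\<rparr>"

lemma tree_aut_length:
  fixes g :: "'a::finite list \<Rightarrow> 'a list"
  assumes "g \<in> carrier tree_aut"
  shows "length (g \<sigma>) = length \<sigma>"
proof -
  have bij: "bij g" and pre: "\<And>\<sigma> \<tau>. prefix \<sigma> \<tau> \<Longrightarrow> prefix (g \<sigma>) (g \<tau>)"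
    using assms by (auto simp: tree_aut_def)
  have ge: "length \<tau> \<le> length (g \<tau>)" for \<tau>
  proof (induction \<tau> rule: rev_induct)
    case (snoc i \<tau>)
    have "prefix (g \<tau>) (g (\<tau> @ [i]))" by (simp add: pre)
    moreover have "g \<tau> \<noteq> g (\<tau> @ [i])" using bij by (metis bij_pointE append_self_conv not_Cons_self2)
    ultimately have "length (g \<tau>) < length (g (\<tau> @ [i]))"
      by (simp add: prefix_length_less strict_prefix_def)
    with snoc show ?case by simp
  qed simp
  define B where "B = {\<tau> :: 'a list. length \<tau> \<le> length \<sigma>}"
  have fin: "finite B" using finite_lists_length_le[of "UNIV :: 'a set"] by (simp add: B_def)
  have "inv_into UNIV g ` B \<subseteq> B"
  proof safe
    fix \<tau> assume "\<tau> \<in> B"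
    have "length (inv_into UNIV g \<tau>) \<le> length (g (inv_into UNIV g \<tau>))" by (rule ge)
    also have "\<dots> = length \<tau>" using bij by (simp add: bij_is_surj surj_f_inv_f)
    finally show "inv_into UNIV g \<tau> \<in> B" using \<open>\<tau> \<in> B\<close> by (simp add: B_def)
  qed
  moreover have "inj_on (inv_into UNIV g) B" using bij by (meson bij_imp_bij_inv bij_is_inj inj_on_subset subset_UNIV)
  ultimately have "inv_into UNIV g ` B = B" using fin by (simp add: endo_inj_surj)
  moreover have "\<sigma> \<in> B" by (simp add: B_def)
  ultimately obtain \<tau> where "\<tau> \<in> B" "\<sigma> = inv_into UNIV g \<tau>" by blast
  then have "length (g \<sigma>) \<le> length \<sigma>"
    using bij by (simp add: B_def bij_is_surj surj_f_inv_f)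
  with ge[of \<sigma>] show ?thesis by simp
qed

lemma tree_aut_prefix_iff:
  assumes "g \<in> carrier tree_aut"
  shows "prefix (g \<sigma>) (g \<tau>) \<longleftrightarrow> prefix \<sigma> \<tau>"
proof
  have bij: "bij g" and pre: "\<And>\<sigma> \<tau>. prefix \<sigma> \<tau> \<Longrightarrow> prefix (g \<sigma>) (g \<tau>)"
    using assms by (auto simp: tree_aut_def)
  show "prefix (g \<sigma>) (g \<tau>)" if "prefix \<sigma> \<tau>" using pre that .
  assume *: "prefix (g \<sigma>) (g \<tau>)"
  define \<sigma>' where "\<sigma>' = take (length \<sigma>) \<tau>"
  have "length \<sigma> \<le> length \<tau>"
    using prefix_length_le[OF *] by (simp add: tree_aut_length[OF assms])
  then have "length (g \<sigma>') = length (g \<sigma>)"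
    by (simp add: tree_aut_length[OF assms] \<sigma>'_def)
  moreover have "prefix (g \<sigma>') (g \<tau>)" by (simp add: pre \<sigma>'_def take_is_prefix)
  ultimately have "g \<sigma>' = g \<sigma>" using * by (metis prefix_def append_eq_append_conv)
  then have "\<sigma>' = \<sigma>" using bij by (auto dest: bij_is_inj injD)
  then show "prefix \<sigma> \<tau>" by (metis \<sigma>'_def take_is_prefix)
qed

lemma group_tree_aut: "group tree_aut"
proof (rule groupI)
  fix g :: "'a::finite list \<Rightarrow> 'a list" assume g: "g \<in> carrier tree_aut"
  then have bij: "bij g" by (simp add: tree_aut_def)
  have "prefix (inv_into UNIV g \<sigma>) (inv_into UNIV g \<tau>)" if "prefix \<sigma> \<tau>" for \<sigma> \<tau>
    using that tree_aut_prefix_iff[OF g, of "inv_into UNIV g \<sigma>" "inv_into UNIV g \<tau>"] bij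
    by (simp add: bij_is_surj surj_f_inv_f)
  with bij have "inv_into UNIV g \<in> carrier tree_aut" by (simp add: tree_aut_def bij_imp_bij_inv)
  moreover have "inv_into UNIV g \<otimes>\<^bsub>tree_aut\<^esub> g = \<one>\<^bsub>tree_aut\<^esub>"
    using bij by (simp add: tree_aut_def bij_is_inj)
  ultimately show "\<exists>h\<in>carrier tree_aut. h \<otimes>\<^bsub>tree_aut\<^esub> g = \<one>\<^bsub>tree_aut\<^esub>" by blast
qed (auto simp: tree_aut_def bij_comp comp_assoc)


section \<open>Branch groups\<close>

definition vertex_stab :: "('a::finite list \<Rightarrow> 'a list) set \<Rightarrow> 'a list \<Rightarrow> ('a list \<Rightarrow> 'a list) set" where
  "vertex_stab G \<tau> = {g \<in> G. g \<tau> = \<tau>}"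

text \<open>The intersection with \<open>G\<close> matters only where the index set is empty, as for the root.\<close>

definition rist :: "('a::finite list \<Rightarrow> 'a list) set \<Rightarrow> 'a list \<Rightarrow> ('a list \<Rightarrow> 'a list) set" where
  "rist G \<sigma> = G \<inter> (\<Inter>\<tau> \<in> {\<tau>. \<not> prefix \<sigma> \<tau>}. vertex_stab G \<tau>)"

text \<open>
  Rigid stabilizers of distinct vertices of the same level commute and have independent supports;
  their (internal direct) product is the subgroup they generate.
\<close>

definition rist_level :: "('a::finite list \<Rightarrow> 'a list) set \<Rightarrow> nat \<Rightarrow> ('a list \<Rightarrow> 'a list) set" where
  "rist_level G n = generate tree_aut (\<Union>\<sigma> \<in> {\<sigma>. length \<sigma> = n}. rist G \<sigma>)"

definition branch_group :: "('a::finite list \<Rightarrow> 'a list) set \<Rightarrow> bool" where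
  "branch_group G \<longleftrightarrow>
     subgroup G tree_aut \<and>
     (\<forall>n \<sigma> \<tau>. length \<sigma> = n \<and> length \<tau> = n \<longrightarrow> (\<exists>g\<in>G. g \<sigma> = \<tau>)) \<and>
     (\<forall>n. finite (rcosets\<^bsub>tree_aut\<lparr>carrier := G\<rparr>\<^esub> (rist_level G n)))"


section \<open>Free groups\<close>

text \<open>
  A letter \<open>(False, x)\<close> stands for the generator \<open>x\<close> and \<open>(True, x)\<close> for its formal inverse.
\<close>

type_synonym 'a letter = "bool \<times> 'a"

definition inv_letter :: "'a letter \<Rightarrow> 'a letter" where
  "inv_letter l = (\<not> fst l, snd l)"

definition reduced :: "'a letter list \<Rightarrow> bool" where
  "reduced w \<longleftrightarrow> successively (\<lambda>l m. m \<noteq> inv_letter l) w"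

fun push :: "'a letter \<Rightarrow> 'a letter list \<Rightarrow> 'a letter list" where
  "push l [] = [l]"
| "push l (m # w) = (if m = inv_letter l then w else l # m # w)"

definition reduce :: "'a letter list \<Rightarrow> 'a letter list" where
  "reduce w = foldr push w []"

definition free_group :: "'a set \<Rightarrow> 'a letter list monoid" where
  "free_group S =
    \<lparr>carrier = {w. reduced w \<and> snd ` set w \<subseteq> S},
     mult = (\<lambda>u v. reduce (u @ v)), one = []\<rparr>"

lemma inv_letter_inv_letter [simp]: "inv_letter (inv_letter l) = l"
  by (simp add: inv_letter_def)

lemma snd_inv_letter [simp]: "snd (inv_letter l) = snd l"
  by (simp add: inv_letter_def)

lemma inv_letter_neq [simp]: "inv_letter l \<noteq> l" "l \<noteq> inv_letter l"
  by (auto simp: inv_letter_def prod_eq_iff)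

lemma reduced_Nil [simp]: "reduced []"
  by (simp add: reduced_def)

lemma reduced_Cons: "reduced (l # w) \<longleftrightarrow> reduced w \<and> (w \<noteq> [] \<longrightarrow> hd w \<noteq> inv_letter l)"
  by (cases w) (auto simp: reduced_def)

lemma reduced_push: "reduced w \<Longrightarrow> reduced (push l w)"
  by (cases w) (auto simp: reduced_Cons)

lemma reduced_foldr_push: "reduced w \<Longrightarrow> reduced (foldr push u w)"
  by (induction u) (auto simp: reduced_push)

lemma set_push: "set (push l w) \<subseteq> insert l (set w)"
  by (cases w) auto

lemma set_foldr_push: "set (foldr push u w) \<subseteq> set u \<union> set w"
proof (induction u)
  case (Cons l u)
  then show ?case using set_push[of l "foldr push u w"] by auto
qed simp

lemma push_push_inv: "reduced w \<Longrightarrow> push l (push (inv_letter l) w) = w"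
  by (cases w; cases "tl w") (auto simp: reduced_Cons)

lemma foldr_push_push:
  "reduced u \<Longrightarrow> reduced w \<Longrightarrow> foldr push (push l u) w = push l (foldr push u w)"
  by (cases u) (auto simp: push_push_inv reduced_foldr_push)

lemma foldr_push_reduce: "reduced w \<Longrightarrow> foldr push (reduce u) w = foldr push u w"
  by (induction u) (auto simp: reduce_def foldr_push_push reduced_foldr_push)

lemma reduce_reduced: "reduced w \<Longrightarrow> reduce w = w"
proof (induction w)
  case (Cons l w)
  then have "reduce (l # w) = push l w" by (simp add: reduce_def reduced_Cons)
  also have "\<dots> = l # w" using Cons.prems by (cases w) (auto simp: reduced_Cons)
  finally show ?case .
qed (simp add: reduce_def)

lemma reduced_reduce: "reduced (reduce w)"
  by (simp add: reduce_def reduced_foldr_push)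

lemma reduce_append: "reduce (u @ v) = foldr push u (reduce v)"
  by (simp add: reduce_def)

lemma group_free_group: "group (free_group S)"
proof (rule groupI)
  fix u v w assume *: "u \<in> carrier (free_group S)" "v \<in> carrier (free_group S)"
    "w \<in> carrier (free_group S)"
  show "u \<otimes>\<^bsub>free_group S\<^esub> v \<in> carrier (free_group S)"
    using *(1,2) set_foldr_push[of "u @ v" "[]"]
    by (fastforce simp: free_group_def reduced_reduce reduce_def simp del: foldr_append
        intro!: reduced_foldr_push)
  show "u \<otimes>\<^bsub>free_group S\<^esub> v \<otimes>\<^bsub>free_group S\<^esub> w
      = u \<otimes>\<^bsub>free_group S\<^esub> (v \<otimes>\<^bsub>free_group S\<^esub> w)"
  proof -
    have "reduce (reduce (u @ v) @ w) = foldr push (u @ v) w"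
      using * by (simp add: free_group_def foldr_push_reduce reduce_append[of "reduce _"]
          reduce_reduced del: foldr_append)
    also have "\<dots> = reduce (u @ reduce (v @ w))"
      using * by (simp add: free_group_def reduce_append reduce_reduced reduced_foldr_push)
    finally show ?thesis by (simp add: free_group_def)
  qed
next
  fix u assume u: "u \<in> carrier (free_group S)"
  define u' where "u' = rev (map inv_letter u)"
  have "foldr push (rev (map inv_letter v)) (v @ w) = w" for v w :: "'a letter list"
    by (induction v) (auto simp: inv_letter_def)
  from this[of u "[]"] have "reduce (u' @ u) = []"
    using u by (simp add: reduce_append reduce_reduced free_group_def u'_def)
  moreover have "reduced u'"
    using u by (simp add: free_group_def u'_def reduced_def successively_rev successively_map)
       (auto elim!: successively_mono[rotated, rotated] simp: inv_letter_def)
  then have "u' \<in> carrier (free_group S)"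
    using u by (auto simp: free_group_def u'_def)
  ultimately show "\<exists>v\<in>carrier (free_group S). v \<otimes>\<^bsub>free_group S\<^esub> u = \<one>\<^bsub>free_group S\<^esub>"
    by (auto simp: free_group_def)
qed (auto simp: free_group_def reduce_reduced)


section \<open>L-presentations\<close>

definition normal_closure :: "('a, 'b) monoid_scheme \<Rightarrow> 'a set \<Rightarrow> 'a set" where
  "normal_closure G A = \<Inter>{N. N \<lhd> G \<and> A \<subseteq> N}"

inductive_set endo_monoid :: "('a \<Rightarrow> 'a) set \<Rightarrow> ('a \<Rightarrow> 'a) set" for \<Phi> where
  one: "id \<in> endo_monoid \<Phi>"
| comp: "\<lbrakk>\<phi> \<in> \<Phi>; \<psi> \<in> endo_monoid \<Phi>\<rbrakk> \<Longrightarrow> \<phi> \<circ> \<psi> \<in> endo_monoid \<Phi>"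

definition L_presentation ::
  "'a set \<Rightarrow> 'a letter list set \<Rightarrow> ('a letter list \<Rightarrow> 'a letter list) set \<Rightarrow> 'a letter list set \<Rightarrow> bool"
where
  "L_presentation S Q \<Phi> R \<longleftrightarrow>
     Q \<subseteq> carrier (free_group S) \<and> R \<subseteq> carrier (free_group S) \<and>
     \<Phi> \<subseteq> hom (free_group S) (free_group S)"

definition L_group ::
  "'a set \<Rightarrow> 'a letter list set \<Rightarrow> ('a letter list \<Rightarrow> 'a letter list) set \<Rightarrow> 'a letter list set \<Rightarrow>
   'a letter list set monoid"
where
  "L_group S Q \<Phi> R =
     free_group S Mod normal_closure (free_group S) (Q \<union> (\<Union>\<phi> \<in> endo_monoid \<Phi>. \<phi> ` R))"

text \<open>
  Since only finite symbol sets occur, natural numbers as symbols are no loss of generality.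
\<close>

definition finitely_L_presented :: "('g, 'b) monoid_scheme \<Rightarrow> bool" where
  "finitely_L_presented G \<longleftrightarrow>
     (\<exists>(S :: nat set) Q \<Phi> R. L_presentation S Q \<Phi> R \<and>
        finite S \<and> finite Q \<and> finite \<Phi> \<and> finite R \<and> G \<cong> L_group S Q \<Phi> R)"


section \<open>The group and its subgroup\<close>

text \<open>
  The alphabet \<open>{1, 2, 3}\<close> with addition modulo 3 is the numeral type \<open>3\<close>, whose elements are the
  residues modulo 3; in particular \<open>3 = 0\<close> and \<open>3 + 1 = 1\<close>.
\<close>

fun tree_a :: "3 list \<Rightarrow> 3 list" where
  "tree_a [] = []"
| "tree_a (i # \<tau>) = (i + 1) # \<tau>"

fun tree_s :: "3 list \<Rightarrow> 3 list" where
  "tree_s [] = []"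
| "tree_s (i # \<tau>) = i # (if i = 3 then tree_s \<tau> else tree_a \<tau>)"

definition psi :: "(3 list \<Rightarrow> 3 list) \<Rightarrow>
    (3 list \<Rightarrow> 3 list) \<times> (3 list \<Rightarrow> 3 list) \<times> (3 list \<Rightarrow> 3 list)" where
  "psi g = (\<lambda>\<tau>. tl (g (1 # \<tau>)), \<lambda>\<tau>. tl (g (2 # \<tau>)), \<lambda>\<tau>. tl (g (3 # \<tau>)))"

lemma psi_tree_s: "psi tree_s = (tree_a, tree_a, tree_s)"
  by (simp add: psi_def)

definition Gamma_bar :: "(3 list \<Rightarrow> 3 list) set" where
  "Gamma_bar = generate tree_aut {tree_a, tree_s}"

definition tree_x :: "3 list \<Rightarrow> 3 list" where
  "tree_x = tree_s \<otimes>\<^bsub>tree_aut\<^esub> inv\<^bsub>tree_aut\<^esub> tree_a"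

definition tree_y :: "3 list \<Rightarrow> 3 list" where
  "tree_y = inv\<^bsub>tree_aut\<^esub> tree_a \<otimes>\<^bsub>tree_aut\<^esub> tree_s"

definition K_subgroup :: "(3 list \<Rightarrow> 3 list) set" where
  "K_subgroup = generate tree_aut {tree_x, tree_y}"

lemma tree_a_in_tree_aut: "tree_a \<in> carrier tree_aut"
proof -
  have "tree_a (tree_a (tree_a \<tau>)) = \<tau>" for \<tau>
    by (cases \<tau>) (simp_all add: add.assoc)
  then have "bij tree_a" by (intro o_bij[of "tree_a \<circ> tree_a"]) (auto simp: fun_eq_iff)
  moreover have "prefix (tree_a \<sigma>) (tree_a \<tau>)" if "prefix \<sigma> \<tau>" for \<sigma> \<tau>
    using that by (cases \<sigma>; cases \<tau>) auto
  ultimately show ?thesis by (simp add: tree_aut_def)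
qed

lemma tree_s_in_tree_aut: "tree_s \<in> carrier tree_aut"
proof -
  have a3: "tree_a (tree_a (tree_a \<tau>)) = \<tau>" for \<tau>
    by (cases \<tau>) (simp_all add: add.assoc)
  have "tree_s (tree_s (tree_s \<tau>)) = \<tau>" for \<tau>
    by (induction \<tau>) (simp_all add: a3)
  then have "bij tree_s" by (intro o_bij[of "tree_s \<circ> tree_s"]) (auto simp: fun_eq_iff)
  moreover have "prefix (tree_s \<sigma>) (tree_s \<tau>)" if "prefix \<sigma> \<tau>" for \<sigma> \<tau>
    using that
  proof (induction \<sigma> arbitrary: \<tau>)
    case (Cons i \<sigma>)
    then obtain \<tau>' where \<tau>: "\<tau> = i # \<tau>'" "prefix \<sigma> \<tau>'" by (cases \<tau>) auto
    moreover have "prefix (tree_a \<sigma>) (tree_a \<tau>')"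
      using tree_a_in_tree_aut \<tau>(2) by (simp add: tree_aut_def)
    ultimately show ?case using Cons.IH by simp
  qed simp
  ultimately show ?thesis by (simp add: tree_aut_def)
qed

lemma subgroup_Gamma_bar: "subgroup Gamma_bar tree_aut"
  unfolding Gamma_bar_def
  by (intro group.generate_is_subgroup group_tree_aut)
     (simp add: tree_a_in_tree_aut tree_s_in_tree_aut)

lemma subgroup_K_subgroup: "subgroup K_subgroup tree_aut"
proof -
  interpret group tree_aut by (rule group_tree_aut)
  show ?thesis unfolding K_subgroup_def tree_x_def tree_y_def
    by (intro generate_is_subgroup) (simp add: tree_a_in_tree_aut tree_s_in_tree_aut)
qed

end

(*
  Conjugating sections by powers of the rotation turns K into the group generated by
  x = tau (x, 1, 1) and y = tau (1, 1, y), a recursion defined on the free group F on x and y.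
  Each letter of a word occurs in exactly one of its three sections. Hence exponent sums add up over
  the sections, so they vanish on words that are trivial in K, and long reduced words get shorter.

  The endomorphism sigma: x -> x y^-1 = (1, y^-1, x), y -> x^-1 y = (x^-1, 1, y) satisfies
  sigma w = (1, 1, w) for w in F'. Thus a trivial word with sections w_i agrees, up to a word all of
  whose sections are trivial in F, with a product of conjugates of the words sigma w_i, and it
  remains to see that the words with trivial sections are normally generated by finitely many of
  them. With p_i = x^i p_0 x^-i and p_0 = x y^-1, seven commutation relations suffice to show that
  the three conjugates of sigma F' commute with each other and are permuted by F; modulo them the
  group is abelian-by-cyclic, generated by p_-1, p_0, p_1 and x, with a normal form readable from
  the exponent sums of the sections. Gamma_bar is the extension of K by the rotation a.

  Neither group is branch: modulo F', each section of an element of K fixing the first level is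
  determined by the other two, so the rigid stabilizers of the first level have exponent sum zero.
*)

theory Submission
  imports Defs
begin

section \<open>Words and their values\<close>

text \<open>The relators come from two elements with trivial third section (vertex 0 in the code): z
  = x^3 p_0^-1, where x^3 = (x, x, x), and v = p_1^-1 z. In the coordinates of the overview p_-1 =
  (x, 1, y^-1), p_0 = (1, y^-1, x), p_1 = (y^-1, x, 1), z = (x, xy, 1), v = (yx, y, 1). So [p_-1, v]
  lives in coordinate 1 and [z, p_0] in coordinate 2, and each relator is a commutator of two
  elements whose sections commute in F coordinate by coordinate. The obstacle: z and v must commute
  with all of sigma F', which is infinitely many conditions. Modulo the relators, [z, sigma w]
  depends only on the exponent sum of x in w, and [v, sigma w] only on that of y. This needs p_-1 to
  commute with [z, p_0^n] for every integer n, and p_0 with [v, p_-1^n]; it is obtained by trading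
  conjugation by p_0 for conjugation by v, and by p_-1 for z^-1. Once z and v centralize sigma F',
  so does p_1 = z v^-1, and x^3 = z p_0 normalizes it. Computations modulo relators are carried out
  in arbitrary groups and transferred to a quotient of F through its faithful action on its own
  elements by translation.\<close>

text \<open>
  The library has a type class for non-commutative groups only in additive notation, so abstract
  group elements are written additively, with \<open>g + h\<close> for the product.
\<close>

fun wev :: "('a \<Rightarrow> 'g::group_add) \<Rightarrow> 'a letter list \<Rightarrow> 'g" where
  "wev c [] = 0"
| "wev c (l # w) = (if fst l then - c (snd l) else c (snd l)) + wev c w"

definition winv :: "'a letter list \<Rightarrow> 'a letter list" where
  "winv w = rev (map inv_letter w)"

lemma winv_Nil [simp]: "winv [] = []"
  and winv_Cons: "winv (l # w) = winv w @ [inv_letter l]"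
  and winv_append: "winv (u @ v) = winv v @ winv u"
  by (simp_all add: winv_def)

lemma winv_winv [simp]: "winv (winv w) = w"
  by (simp add: winv_def rev_map comp_def)

lemma letters_winv [simp]: "snd ` set (winv w) = snd ` set w"
  by (simp add: winv_def image_image)

lemma wev_append [simp]: "wev c (u @ v) = wev c u + wev c v"
  by (induction u) (simp_all add: add.assoc)

lemma wev_winv [simp]: "wev c (winv w) = - wev c w"
  by (induction w) (auto simp: winv_Cons minus_add inv_letter_def)

lemma wev_push: "wev c (push l w) = wev c (l # w)"
  by (cases w) (auto simp: inv_letter_def simp flip: add.assoc)

lemma wev_reduce [simp]: "wev c (reduce w) = wev c w"
proof (induction w)
  case (Cons l w)
  have "wev c (reduce (l # w)) = wev c (l # reduce w)"
    using wev_push[of c l] by (simp add: reduce_def)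
  then show ?case using Cons by simp
qed (simp add: reduce_def)

lemma reduce_Nil [simp]: "reduce [] = []"
  by (simp add: reduce_def)

lemma reduce_Cons: "reduce (l # w) = push l (reduce w)"
  by (simp add: reduce_def)

lemma reduce_reduce [simp]: "reduce (reduce w) = reduce w"
  by (simp add: reduce_reduced reduced_reduce)

lemma reduce_append_left: "reduce (reduce u @ v) = reduce (u @ v)"
  by (simp add: reduce_append foldr_push_reduce reduced_reduce)

lemma reduce_append_right: "reduce (u @ reduce v) = reduce (u @ v)"
  by (simp add: reduce_append)

lemma reduce_append_cong:
  "reduce u = reduce u' \<Longrightarrow> reduce v = reduce v' \<Longrightarrow> reduce (u @ v) = reduce (u' @ v')"
  by (metis reduce_append_left reduce_append_right)

lemma reduce_winv_append [simp]: "reduce (winv u @ u) = []"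
proof -
  have "foldr push (winv u) (foldr push u w) = w" if "reduced w" for w
    using that
  proof (induction u arbitrary: w)
    case (Cons l u)
    have "push (inv_letter l) (push l (foldr push u w)) = foldr push u w"
      using push_push_inv[of "foldr push u w" "inv_letter l"] Cons.prems
      by (simp add: reduced_foldr_push)
    then show ?case using Cons by (simp add: winv_Cons)
  qed simp
  then show ?thesis by (simp add: reduce_def)
qed

lemma reduce_append_winv [simp]: "reduce (u @ winv u) = []"
  using reduce_winv_append[of "winv u"] by simp

lemma reduce_eqI:
  assumes "reduce (u @ winv v) = []"
  shows "reduce u = reduce v"
proof -
  have "reduce u = reduce (u @ (winv v @ v))"
    by (metis append_Nil2 reduce_append_cong reduce_winv_append reduce_Nil)
  also have "\<dots> = reduce ([] @ v)"
    using assms by (metis append_assoc reduce_append_cong reduce_Nil)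
  finally show ?thesis by simp
qed

lemma reduce_winv: "reduce (winv (reduce w)) = reduce (winv w)"
proof (rule reduce_eqI)
  have "reduce (winv (reduce w) @ w) = reduce (winv (reduce w) @ reduce w)"
    by (simp add: reduce_append_right)
  then show "reduce (winv (reduce w) @ winv (winv w)) = []" by simp
qed

lemma letters_reduce: "snd ` set (reduce w) \<subseteq> snd ` set w"
  using set_foldr_push[of w "[]"] by (auto simp: reduce_def)

lemma length_reduce: "length (reduce w) \<le> length w"
proof (induction w)
  case (Cons l w)
  have "length (push l u) \<le> Suc (length u)" for u :: "'a letter list" by (cases u) auto
  then show ?case using Cons by (metis reduce_Cons le_trans length_Cons Suc_le_mono)
qed simp

lemma carrier_free_group: "w \<in> carrier (free_group S) \<longleftrightarrow> reduced w \<and> snd ` set w \<subseteq> S"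
  by (simp add: free_group_def)

lemma reduce_in_carrier: "snd ` set w \<subseteq> S \<Longrightarrow> reduce w \<in> carrier (free_group S)"
  using letters_reduce[of w] by (auto simp: carrier_free_group reduced_reduce)

lemma mult_free_group: "u \<otimes>\<^bsub>free_group S\<^esub> v = reduce (u @ v)"
  and one_free_group: "\<one>\<^bsub>free_group S\<^esub> = []"
  by (simp_all add: free_group_def)

lemma inv_free_group:
  assumes "w \<in> carrier (free_group S)"
  shows "inv\<^bsub>free_group S\<^esub> w = reduce (winv w)"
proof -
  interpret group "free_group S" by (rule group_free_group)
  have "reduce (winv w) \<in> carrier (free_group S)"
    using assms letters_winv[of w] by (intro reduce_in_carrier) (simp add: carrier_free_group)
  with assms show ?thesis
    by (intro inv_equality) (simp_all add: mult_free_group one_free_group reduce_append_left)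
qed

text \<open>Substituted words are left unreduced, so that values, letters and sections follow by
  plain recursion; \<open>reduce\<close> is applied only where a free group element is
  meant.\<close>

fun wsub :: "('a \<Rightarrow> 'b letter list) \<Rightarrow> 'a letter list \<Rightarrow> 'b letter list" where
  "wsub h [] = []"
| "wsub h (l # w) = (if fst l then winv (h (snd l)) else h (snd l)) @ wsub h w"

lemma wsub_append [simp]: "wsub h (u @ v) = wsub h u @ wsub h v"
  by (induction u) simp_all

lemma wev_wsub: "wev c (wsub h w) = wev (\<lambda>k. wev c (h k)) w"
  by (induction w) auto

lemma letters_wsub: "snd ` set (wsub h w) = (\<Union>k \<in> snd ` set w. snd ` set (h k))"
proof (induction w)
  case (Cons l w)
  have "snd ` set (wsub h (l # w)) = snd ` set (h (snd l)) \<union> snd ` set (wsub h w)"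
    by (simp add: image_Un)
  then show ?case by (simp add: Cons)
qed simp

lemma reduce_wsub_push: "reduce (wsub h (push l w)) = reduce (wsub h (l # w))"
proof (cases "w \<noteq> [] \<and> hd w = inv_letter l")
  case True
  then obtain w' where w: "w = inv_letter l # w'" by (cases w) auto
  have "wsub h (l # w) = (wsub h [l] @ wsub h [inv_letter l]) @ wsub h w'"
    by (simp add: w)
  moreover have "reduce (wsub h [l] @ wsub h [inv_letter l]) = reduce []"
    by (auto simp: inv_letter_def)
  ultimately have "reduce (wsub h (l # w)) = reduce ([] @ wsub h w')"
    by (metis reduce_append_cong)
  then show ?thesis by (simp add: w)
qed (cases w; auto)

lemma reduce_wsub [simp]: "reduce (wsub h (reduce w)) = reduce (wsub h w)"
proof (induction w)
  case (Cons l w)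
  have "reduce (wsub h (reduce (l # w))) = reduce (wsub h [l] @ wsub h (reduce w))"
    by (simp add: reduce_Cons reduce_wsub_push)
  also have "\<dots> = reduce (wsub h [l] @ wsub h w)" using Cons by (metis reduce_append_cong)
  finally show ?case by simp
qed simp

lemma wsub_hom:
  assumes "\<And>k. k \<in> S \<Longrightarrow> snd ` set (h k) \<subseteq> S'"
  shows "(\<lambda>w. reduce (wsub h w)) \<in> hom (free_group S) (free_group S')"
proof (rule homI)
  fix u v assume "u \<in> carrier (free_group S)" "v \<in> carrier (free_group S)"
  then show "reduce (wsub h u) \<in> carrier (free_group S')"
    using assms by (intro reduce_in_carrier) (auto simp only: carrier_free_group letters_wsub)
qed (simp add: mult_free_group reduce_append_left reduce_append_right)


section \<open>Quotients of free groups act faithfully\<close>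

text \<open>Quotients of free groups have carriers inside a type, whereas \<open>group_add\<close>
  demands a whole type. Bijections provide one in which both such quotients and tree automorphisms
  can be evaluated.\<close>

typedef 'b bijection = "{f :: 'b \<Rightarrow> 'b. bij f}"
  morphisms app Bijection by (auto intro: bij_id)

lemma bij_app: "bij (app f)"
  using app by simp

instantiation bijection :: (type) group_add
begin

definition "0 = Bijection id"
definition "f + g = Bijection (app f \<circ> app g)"
definition "- f = Bijection (inv_into UNIV (app f))"
definition "f - g = f + - (g :: 'a bijection)"

instance
proof
  fix f g h :: "'a bijection"
  show "f + g + h = f + (g + h)"
    by (simp add: plus_bijection_def Bijection_inverse bij_app bij_comp comp_assoc)
  show "0 + f = f" "f + 0 = f"
    by (simp_all add: plus_bijection_def zero_bijection_def Bijection_inverse app_inverse)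
  show "- f + f = 0"
    by (simp add: plus_bijection_def zero_bijection_def uminus_bijection_def Bijection_inverse
        bij_app bij_imp_bij_inv bij_is_inj)
  show "f + - g = f - g"
    by (simp add: minus_bijection_def)
qed

end

lemma app_zero [simp]: "app 0 = id"
  and app_plus [simp]: "app (f + g) = app f \<circ> app g"
  and app_minus: "app (- f) = inv_into UNIV (app f)"
  by (simp_all add: zero_bijection_def plus_bijection_def uminus_bijection_def Bijection_inverse
      bij_app bij_comp bij_imp_bij_inv)

text \<open>Cayley's theorem: left translation on the quotient is faithful, so a word acts as the
  identity exactly when it lies in \<open>N\<close>.\<close>

lemma free_group_quotient_action:
  assumes "N \<lhd> free_group S"
  obtains c :: "'a \<Rightarrow> 'a letter list set bijection"
  where "\<And>w. snd ` set w \<subseteq> S \<Longrightarrow> wev c w = 0 \<longleftrightarrow> reduce w \<in> N"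
proof -
  interpret N: normal N "free_group S" by (rule assms)
  define Q where "Q = free_group S Mod N"
  interpret Q: group Q unfolding Q_def by (rule N.factorgroup_is_group)
  define \<pi> where "\<pi> w = N #>\<^bsub>free_group S\<^esub> reduce w" for w
  have pi_carr: "\<pi> w \<in> carrier Q" if "snd ` set w \<subseteq> S" for w
    using that reduce_in_carrier[OF that] by (auto simp: \<pi>_def Q_def FactGroup_def RCOSETS_def)
  have pi_append: "\<pi> (u @ v) = \<pi> u \<otimes>\<^bsub>Q\<^esub> \<pi> v" if "snd ` set u \<subseteq> S" "snd ` set v \<subseteq> S" for u v
    using that reduce_in_carrier[OF that(1)] reduce_in_carrier[OF that(2)]
    by (simp add: \<pi>_def Q_def FactGroup_def N.rcos_sum mult_free_group
        reduce_append_left reduce_append_right)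
  have pi_Nil: "\<pi> [] = \<one>\<^bsub>Q\<^esub>"
    using N.coset_mult_one[OF N.subset]
    unfolding \<pi>_def Q_def FactGroup_def one_free_group by simp
  \<comment> \<open>The identity outside the carrier makes a translation a bijection of the whole
    type.\<close>
  define lt where "lt q z = (if z \<in> carrier Q then q \<otimes>\<^bsub>Q\<^esub> z else z)" for q z
  have lt_one: "lt \<one>\<^bsub>Q\<^esub> = id" by (rule ext) (simp add: lt_def)
  have lt_mult: "lt (p \<otimes>\<^bsub>Q\<^esub> q) = lt p \<circ> lt q" if "p \<in> carrier Q" "q \<in> carrier Q" for p q
    using that by (intro ext) (simp add: lt_def Q.m_assoc)
  have lt_bij: "bij (lt q)" if "q \<in> carrier Q" for q
  proof (rule o_bij)
    show "lt (inv\<^bsub>Q\<^esub> q) \<circ> lt q = id" "lt q \<circ> lt (inv\<^bsub>Q\<^esub> q) = id"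
      using that lt_mult[of "inv\<^bsub>Q\<^esub> q" q] lt_mult[of q "inv\<^bsub>Q\<^esub> q"] lt_one by simp_all
  qed
  \<comment> \<open>Symbols outside \<open>S\<close> need not give an element of the quotient, so
    translation by them may fail to be bijective; they act trivially.\<close>
  define c where "c k = (if k \<in> S then Bijection (lt (\<pi> [(False, k)])) else 0)" for k
  have c: "app (c k) = lt (\<pi> [(False, k)])" if "k \<in> S" for k
    using that by (simp add: c_def Bijection_inverse lt_bij pi_carr)
  have c': "app (- c k) = lt (\<pi> [(True, k)])" if "k \<in> S" for k
  proof -
    have "\<pi> [(False, k)] \<otimes>\<^bsub>Q\<^esub> \<pi> [(True, k)] = \<pi> ([(False, k)] @ [(True, k)])"
      using that by (intro pi_append[symmetric]) auto
    also have "\<dots> = \<one>\<^bsub>Q\<^esub>"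
      unfolding pi_Nil[symmetric] by (simp add: \<pi>_def reduce_def inv_letter_def)
    finally have "app (c k) \<circ> lt (\<pi> [(True, k)]) = id"
      using that lt_mult[of "\<pi> [(False, k)]" "\<pi> [(True, k)]"] by (simp add: c pi_carr lt_one)
    then have "app (- c k) \<circ> (app (c k) \<circ> lt (\<pi> [(True, k)])) = app (- c k)" by simp
    then show ?thesis
      by (metis add.left_inverse app_plus app_zero comp_assoc id_comp)
  qed
  have app_wev: "app (wev c w) = lt (\<pi> w)" if "snd ` set w \<subseteq> S" for w
    using that
  proof (induction w)
    case (Cons l w)
    have "\<pi> (l # w) = \<pi> [l] \<otimes>\<^bsub>Q\<^esub> \<pi> w" using pi_append[of "[l]" w] Cons.prems by simp
    moreover have "app (if fst l then - c (snd l) else c (snd l)) = lt (\<pi> [l])"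
      using Cons.prems by (cases l) (auto simp: c c')
    ultimately show ?case using Cons pi_carr[of "[l]"] pi_carr[of w] by (simp add: lt_mult)
  qed (simp add: lt_one pi_Nil)
  have "wev c w = 0 \<longleftrightarrow> reduce w \<in> N" if w: "snd ` set w \<subseteq> S" for w
  proof -
    have "wev c w = 0 \<longleftrightarrow> lt (\<pi> w) = id" by (metis app_inject app_wev app_zero w)
    also have "\<dots> \<longleftrightarrow> \<pi> w = \<one>\<^bsub>Q\<^esub>"
    proof
      assume "lt (\<pi> w) = id"
      then have "\<pi> w \<otimes>\<^bsub>Q\<^esub> \<one>\<^bsub>Q\<^esub> = \<one>\<^bsub>Q\<^esub>" by (metis Q.one_closed id_apply lt_def)
      then show "\<pi> w = \<one>\<^bsub>Q\<^esub>" using pi_carr[OF w] by simp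
    qed (simp add: lt_one)
    also have "\<dots> \<longleftrightarrow> reduce w \<in> N"
      using N.coset_join1[OF _ reduce_in_carrier[OF w] N.subgroup_axioms] N.rcos_const
      unfolding \<pi>_def Q_def FactGroup_def by (auto simp: N.subgroup_axioms)
    finally show ?thesis .
  qed
  then show thesis by (rule that)
qed

section \<open>Commutators in additive notation\<close>

text \<open>Rewriting to right-nested sums with adjacent inverses cancelled; it proves the
  identities that hold in every group.\<close>

lemmas group_norm =
  diff_conv_add_uminus minus_add minus_minus add.assoc add_0_left add_0_right minus_zero
  left_minus right_minus add_minus_cancel minus_add_cancel

definition gconj :: "'g::group_add \<Rightarrow> 'g \<Rightarrow> 'g" where
  "gconj g a = g + a - g"

definition commutes :: "'g::group_add \<Rightarrow> 'g \<Rightarrow> bool" where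
  "commutes a b \<longleftrightarrow> a + b = b + a"

definition comm :: "'g::group_add \<Rightarrow> 'g \<Rightarrow> 'g" where
  "comm a b = a + b - a - b"

definition zpow :: "'g::group_add \<Rightarrow> int \<Rightarrow> 'g" where
  "zpow g n = (if 0 \<le> n then ((+) g ^^ nat n) 0 else ((+) (- g) ^^ nat (- n)) 0)"

lemma conj_0 [simp]: "gconj g 0 = 0" "gconj 0 a = a"
  and conj_add: "gconj g (a + b) = gconj g a + gconj g b"
  and conj_minus: "gconj g (- a) = - gconj g a"
  and conj_conj: "gconj g (gconj h a) = gconj (g + h) a"
  and conj_minus_self [simp]: "gconj (- g) (gconj g a) = a" "gconj g (gconj (- g) a) = a"
  by (simp_all only: gconj_def group_norm)

lemma conj_plus: "gconj (g + h) a = gconj g (gconj h a)"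
  and conj_diff: "gconj (g - h) a = gconj g (gconj (- h) a)"
  by (simp_all only: gconj_def group_norm)

lemma commutes_iff_conj: "commutes a b \<longleftrightarrow> gconj a b = b"
  by (auto simp: commutes_def gconj_def diff_eq_eq)

lemma commutes_conjD: "commutes a b \<Longrightarrow> gconj (- a) b = b"
  by (metis commutes_iff_conj conj_minus_self(1))

lemma commutes_sym: "commutes a b \<Longrightarrow> commutes b a"
  by (simp add: commutes_def)

lemma commutes_self [simp]: "commutes a a"
  by (simp add: commutes_def)

lemma commutes_0 [simp]: "commutes a 0" "commutes 0 a"
  by (simp_all add: commutes_def)

lemma commutes_add: "commutes a b \<Longrightarrow> commutes a c \<Longrightarrow> commutes a (b + c)"
  by (simp add: commutes_iff_conj conj_add)

lemma commutes_minus: "commutes a b \<Longrightarrow> commutes a (- b)"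
  by (simp add: commutes_iff_conj conj_minus)

lemma commutes_conj: "commutes a g \<Longrightarrow> commutes a b \<Longrightarrow> commutes a (gconj g b)"
  unfolding gconj_def diff_conv_add_uminus by (intro commutes_add commutes_minus)

lemma commutes_conj_iff: "commutes (gconj g a) (gconj g b) \<longleftrightarrow> commutes a b"
proof -
  have "commutes (gconj g a) (gconj g b)" if "commutes a b" for g a b :: 'a
    using that by (simp add: commutes_def flip: conj_add)
  from this[of a b g] this[of "gconj g a" "gconj g b" "- g"] show ?thesis by auto
qed

lemma conj_minus_eqI: "gconj g a = b \<Longrightarrow> gconj (- g) b = a"
  by auto

lemma comm_eq_0_iff: "comm a b = 0 \<longleftrightarrow> commutes a b"
proof -
  have "comm a b = (a + b) - (b + a)" by (simp only: comm_def group_norm)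
  then show ?thesis by (simp add: commutes_def)
qed

lemma comm_eq_conj: "comm a b = gconj a b - b"
  and comm_add_right: "comm a (b + c) = comm a b + gconj b (comm a c)"
  and comm_swap: "comm b a = - comm a b"
  and comm_0 [simp]: "comm a 0 = 0"
  and conj_comm: "gconj g (comm a b) = comm (gconj g a) (gconj g b)"
  by (simp_all only: comm_def gconj_def group_norm)

lemma zpow_0 [simp]: "zpow g 0 = 0"
  by (simp add: zpow_def)

lemma zpow_succ: "zpow g (n + 1) = g + zpow g n"
proof (cases "0 \<le> n")
  case True
  then have "nat (n + 1) = Suc (nat n)" by simp
  with True show ?thesis by (simp add: zpow_def)
next
  case False
  then have "nat (- n) = Suc (nat (- (n + 1)))" by simp
  with False show ?thesis by (cases "n = - 1") (simp_all add: zpow_def flip: add.assoc)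
qed

lemma zpow_pred: "zpow g (n - 1) = - g + zpow g n"
  using zpow_succ[of g "n - 1"] by (simp flip: add.assoc)

lemma commutes_zpow: "commutes a b \<Longrightarrow> commutes a (zpow b n)"
  by (induction n rule: int_induct[of _ 0])
     (simp_all add: zpow_succ zpow_pred commutes_add commutes_minus)

text \<open>
  The hypothesis on \<open>gconj V D\<close> lets conjugation by powers of \<open>P\<close> be replaced by conjugation by
  powers of \<open>V\<close>; this is where finitely many relations yield a family indexed by the integers.
\<close>

lemma commutes_comm_zpow:
  fixes P V P' Z :: "'g::group_add"
  assumes VP: "commutes V P"
    and \<kappa>P: "commutes (comm P' V) P" and \<kappa>D: "commutes (comm P' V) (comm Z P)"
    and P'D: "commutes P' (comm Z P)"
    and VD: "gconj V (comm Z P) = gconj (- P) (comm Z P)"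
  shows "commutes P' (comm Z (zpow P n))"
proof -
  define D where "D = comm Z P"
  define \<kappa> where "\<kappa> = comm P' V"
  define E where "E n = gconj (zpow P n) D" for n
  have down: "gconj V (E n) = E (n - 1)" for n
  proof -
    have "V + zpow P n = zpow P n + V"
      using commutes_zpow[OF VP] by (simp add: commutes_def)
    then have "gconj V (E n) = gconj (zpow P n) (gconj V D)" by (simp add: E_def conj_conj)
    also have "\<dots> = gconj (zpow P n + - P) D" using VD by (simp add: D_def conj_conj)
    also have "zpow P n + - P = - P + zpow P n"
      by (metis commutes_def commutes_minus commutes_self commutes_sym commutes_zpow)
    finally show ?thesis by (simp add: E_def zpow_pred)
  qed
  have \<kappa>E: "commutes \<kappa> (E n)" for n
    unfolding E_def \<kappa>_def D_def by (intro commutes_conj commutes_zpow \<kappa>P \<kappa>D)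
  have P'E: "commutes P' (E n)" for n
  proof (induction n rule: int_induct[of _ 0])
    case base
    then show ?case using P'D by (simp add: E_def D_def)
  next
    case (step1 n)
    have E: "E (n + 1) = gconj (- V) (E n)"
      using down[of "n + 1"] by (metis add_diff_cancel_right' conj_minus_self(1))
    \<comment> \<open>By definition of \<open>\<kappa>\<close>, moving \<open>P'\<close> past
      \<open>- V\<close> costs only \<open>- \<kappa>\<close>, and both \<open>P'\<close> (by
      induction) and \<open>\<kappa>\<close> fix \<open>E n\<close>.\<close>
    have "gconj P' (E (n + 1)) = gconj (- V + - \<kappa> + P') (E n)"
      unfolding E conj_conj by (rule arg_cong[where f = "\<lambda>g. gconj g _"])
        (simp only: \<kappa>_def comm_def group_norm)
    also have "\<dots> = gconj (- V) (gconj (- \<kappa>) (E n))"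
      using step1 by (simp add: commutes_iff_conj conj_plus conj_diff)
    also have "gconj (- \<kappa>) (E n) = E n"
      using \<kappa>E[of n] by (rule commutes_conjD)
    finally show ?case by (simp add: commutes_iff_conj E)
  next
    case (step2 n)
    have "gconj P' (E (n - 1)) = gconj (\<kappa> + V + P') (E n)"
      unfolding down[symmetric] conj_conj by (rule arg_cong[where f = "\<lambda>g. gconj g _"])
        (simp only: \<kappa>_def comm_def group_norm)
    also have "\<dots> = gconj \<kappa> (gconj V (E n))"
      using step2 by (simp add: commutes_iff_conj conj_plus conj_diff)
    finally show ?case using \<kappa>E by (simp add: commutes_iff_conj down)
  qed
  have C: "comm Z (zpow P (n + 1)) = comm Z (zpow P n) + E n" for n
  proof -
    have "zpow P (n + 1) = zpow P n + P"
      using commutes_zpow[OF commutes_self] by (simp add: zpow_succ commutes_def)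
    then show ?thesis by (simp add: comm_add_right E_def D_def)
  qed
  show ?thesis
  proof (induction n rule: int_induct[of _ 0])
    case (step1 n)
    then show ?case by (simp add: C commutes_add P'E)
  next
    case (step2 n)
    have "comm Z (zpow P (n - 1)) = comm Z (zpow P n) + - E (n - 1)"
      using C[of "n - 1"] by simp
    then show ?case using step2 by (simp only: commutes_add commutes_minus P'E)
  qed simp
qed


section \<open>Consequences of the seven relators\<close>

definition ex :: "nat letter list \<Rightarrow> int" where
  "ex = wev (\<lambda>k. if k = 0 then 1 else 0)"

text \<open>Every nonzero letter counts as y, here as in \<open>f\<close>, \<open>active\<close> and
  \<open>\<sigma>\<close>, so that identities between these functions hold on arbitrary
  words.\<close>

definition ey :: "nat letter list \<Rightarrow> int" where
  "ey = wev (\<lambda>k. if k = 0 then 0 else 1)"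

text \<open>The first five assumptions are abbreviations, the other seven are the relators. In their
  names \<open>\<kappa>\<close> is \<open>comm pm v\<close> and \<open>D\<close> is
  \<open>comm z p0\<close>.\<close>

locale relations =
  fixes x y p0 pm p1 z v :: "'g::group_add"
  assumes p0: "p0 = x - y" and pm: "pm = - y + x" and p1: "p1 = gconj x p0"
    and z: "z = x + x + x - p0" and v: "v = - p1 + z"
    and v_p0: "commutes v p0" and z_pm: "commutes z pm"
    and \<kappa>_p0: "commutes (comm pm v) p0"
    and D_pm: "commutes (comm z p0) pm"
    and \<kappa>_D: "commutes (comm pm v) (comm z p0)"
    and vp0_D: "commutes (v + p0) (comm z p0)"
    and zpm_\<kappa>: "commutes (z - pm) (comm pm v)"
begin

section \<open>Commutators of \<open>z\<close> and \<open>v\<close> with substituted words\<close>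

definition f :: "nat letter list \<Rightarrow> 'g" where
  "f = wev (\<lambda>k. if k = 0 then p0 else - pm)"

lemma pm_comm_z: "commutes pm (comm z (zpow p0 n))"
proof (rule commutes_comm_zpow[OF v_p0 \<kappa>_p0 \<kappa>_D commutes_sym[OF D_pm]])
  \<comment> \<open>\<open>v\<close> and \<open>p0\<close> commute and their sum fixes
    \<open>comm z p0\<close>, so \<open>v\<close> moves it as \<open>- p0\<close> does.\<close>
  have "gconj (p0 + v) (comm z p0) = comm z p0"
    using v_p0 vp0_D by (simp add: commutes_iff_conj[symmetric]) (simp add: commutes_def)
  then show "gconj v (comm z p0) = gconj (- p0) (comm z p0)"
    by (metis conj_conj conj_minus_self(1))
qed

text \<open>The mirror image of \<open>pm_comm_z\<close>, with \<open>- z\<close> as the shifting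
  element. The commutator \<open>comm p0 (- z)\<close> is the conjugate of \<open>comm z p0\<close>
  by \<open>- z\<close>, so its relations arise from the assumed ones by conjugation.\<close>

lemma p0_comm_v: "commutes p0 (comm v (zpow pm n))"
proof (rule commutes_comm_zpow[where V = "- z"])
  show zpm: "commutes (- z) pm"
    using z_pm by (blast intro: commutes_sym commutes_minus)
  have c: "gconj (- z) (comm z p0) = comm p0 (- z)"
    by (simp only: comm_def gconj_def group_norm)
  have *: "gconj (- z) (comm pm v) = gconj (- pm) (comm pm v)"
  proof -
    have "gconj (z + - pm) (comm pm v) = comm pm v"
      using zpm_\<kappa> by (simp add: commutes_iff_conj)
    then show ?thesis by (metis conj_conj conj_minus_self(1))
  qed
  then show "gconj (- z) (comm v pm) = gconj (- pm) (comm v pm)"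
    by (simp add: comm_swap[of v pm] conj_minus)
  show "commutes (comm p0 (- z)) pm"
    unfolding c[symmetric] using D_pm zpm by (blast intro: commutes_sym commutes_conj)
  have "gconj z (comm pm v) = gconj pm (comm pm v)"
  proof -
    have "gconj (- pm + z) (comm pm v) = comm pm v"
      using zpm_\<kappa> z_pm commutes_minus[OF z_pm] by (simp add: commutes_iff_conj[symmetric]) (simp add: commutes_def)
    then show ?thesis by (metis conj_conj conj_minus_self(2))
  qed
  moreover have "commutes (comm z p0) (gconj pm (comm pm v))"
    using D_pm \<kappa>_D by (blast intro: commutes_sym commutes_conj)
  ultimately have "commutes (gconj (- z) (comm z p0)) (gconj (- z) (gconj z (comm pm v)))"
    by (simp only: commutes_conj_iff)
  then have "commutes (comm p0 (- z)) (comm pm v)" by (simp add: c)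
  then show "commutes (comm p0 (- z)) (comm v pm)"
    by (simp add: comm_swap[of v pm] commutes_minus)
  show "commutes p0 (comm v pm)"
    using commutes_minus[OF commutes_sym[OF \<kappa>_p0]] by (simp add: comm_swap[of v pm])
qed

text \<open>Letters with value \<open>pm\<close> or \<open>- pm\<close> drop out: these commute with
  \<open>z\<close> and, by \<open>pm_comm_z\<close>, with the commutator accumulated so far.\<close>

lemma comm_z_f: "comm z (f u) = comm z (zpow p0 (ex u))"
proof (induction u)
  case (Cons l u)
  have y: "comm z (g + f u) = comm z (zpow p0 (ex u))" if "g = pm \<or> g = - pm" for g
  proof -
    have "commutes g (comm z (zpow p0 (ex u)))"
      using that pm_comm_z by (blast intro: commutes_sym commutes_minus)
    moreover have "comm z g = 0"
      using that z_pm commutes_minus by (auto simp: comm_eq_0_iff)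
    ultimately show ?thesis using Cons by (simp add: comm_add_right commutes_iff_conj)
  qed
  have "ex (l # u) = (if snd l = 0 then (if fst l then ex u - 1 else ex u + 1) else ex u)"
    by (simp add: ex_def)
  with Cons y show ?case
    by (simp add: f_def zpow_succ zpow_pred comm_add_right)
qed (simp add: f_def ex_def)

text \<open>Here the letters with value \<open>p0\<close> or \<open>- p0\<close> drop out. The minus
  sign is due to \<open>f\<close> sending y to \<open>- pm\<close>.\<close>

lemma comm_v_f: "comm v (f u) = comm v (zpow pm (- ey u))"
proof (induction u)
  case (Cons l u)
  define n where "n = - ey u"
  have IH: "comm v (f u) = comm v (zpow pm n)" using Cons by (simp add: n_def)
  have x: "comm v (g + f u) = comm v (zpow pm n)" if "g = p0 \<or> g = - p0" for g
  proof -
    have "commutes g (comm v (zpow pm n))"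
      using that p0_comm_v by (blast intro: commutes_sym commutes_minus)
    moreover have "comm v g = 0"
      using that v_p0 commutes_minus by (auto simp: comm_eq_0_iff)
    ultimately show ?thesis using IH by (simp add: comm_add_right commutes_iff_conj)
  qed
  have "- ey (l # u) = (if snd l = 0 then n else (if fst l then n + 1 else n - 1))"
    by (simp add: ey_def n_def)
  then have "comm v (zpow pm (- ey (l # u))) = (if snd l = 0 then comm v (zpow pm n)
      else comm v ((if fst l then pm else - pm) + zpow pm n))"
    by (simp add: zpow_succ zpow_pred)
  also have "\<dots> = comm v (f (l # u))"
    using x IH by (simp add: f_def comm_add_right)
  finally show ?case by simp
qed (simp add: f_def ey_def)

section \<open>The image of sigma F' (F' is given by vanishing exponent sums; the index 3 names the
  surviving coordinate) and its normalizer\<close>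

definition A3 :: "'g set" where
  "A3 = {f u | u. ex u = 0 \<and> ey u = 0}"

text \<open>With vanishing exponent sums, \<open>comm_z_f\<close> and \<open>comm_v_f\<close> leave
  commutators with \<open>zpow _ 0 = 0\<close>.\<close>

lemma z_A3: "a \<in> A3 \<Longrightarrow> commutes z a" and v_A3: "a \<in> A3 \<Longrightarrow> commutes v a"
  unfolding comm_eq_0_iff[symmetric] by (auto simp: A3_def comm_z_f comm_v_f)

lemma A3_I: "ex u = 0 \<Longrightarrow> ey u = 0 \<Longrightarrow> f u \<in> A3"
  by (auto simp: A3_def)

lemma A3_E: "a \<in> A3 \<Longrightarrow> (\<And>u. a = f u \<Longrightarrow> ex u = 0 \<Longrightarrow> ey u = 0 \<Longrightarrow> thesis) \<Longrightarrow> thesis"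
  by (auto simp: A3_def)

lemma A3_0: "0 \<in> A3"
  using A3_I[of "[]"] by (simp add: f_def ex_def ey_def)

lemma A3_add: "a \<in> A3 \<Longrightarrow> b \<in> A3 \<Longrightarrow> a + b \<in> A3"
proof (elim A3_E)
  fix u w assume "a = f u" "ex u = 0" "ey u = 0" "b = f w" "ex w = 0" "ey w = 0"
  then show "a + b \<in> A3" using A3_I[of "u @ w"] by (simp add: f_def ex_def ey_def)
qed

lemma A3_minus: "a \<in> A3 \<Longrightarrow> - a \<in> A3"
proof (elim A3_E)
  fix u assume "a = f u" "ex u = 0" "ey u = 0"
  then show "- a \<in> A3" using A3_I[of "winv u"] by (simp add: f_def ex_def ey_def)
qed

text \<open>Both signs are demanded because an infinite set may be mapped properly into itself by a
  conjugation.\<close>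

definition normalizes :: "'g \<Rightarrow> 'g set \<Rightarrow> bool" where
  "normalizes g B \<longleftrightarrow> (\<forall>a\<in>B. gconj g a \<in> B \<and> gconj (- g) a \<in> B)"

lemma normalizes_add: "normalizes g B \<Longrightarrow> normalizes h B \<Longrightarrow> normalizes (g + h) B"
  by (auto simp: normalizes_def minus_add conj_plus conj_diff)

lemma normalizes_minus: "normalizes g B \<Longrightarrow> normalizes (- g) B"
  by (auto simp: normalizes_def)

lemma normalizes_0: "normalizes 0 B"
  by (auto simp: normalizes_def)

lemma normalizes_f: "normalizes (f u) A3"
proof -
  have "gconj (f u) a \<in> A3" if "a \<in> A3" for u a
  proof -
    obtain w where "a = f w" "ex w = 0" "ey w = 0" using \<open>a \<in> A3\<close> by (rule A3_E)
    then have "gconj (f u) a = f (u @ w @ winv u)" "ex (u @ w @ winv u) = 0" "ey (u @ w @ winv u) = 0"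
      by (simp_all add: f_def ex_def ey_def gconj_def add_diff_eq)
    then show ?thesis using A3_I by simp
  qed
  moreover have "- f u = f (winv u)" by (simp add: f_def)
  ultimately show ?thesis by (simp add: normalizes_def)
qed

lemma normalizes_A3: "normalizes p0 A3" "normalizes pm A3" "normalizes z A3" "normalizes v A3"
    "normalizes (x + x + x) A3" "normalizes p1 A3"
proof -
  show *: "normalizes p0 A3" "normalizes pm A3"
    using normalizes_f[of "[(False, 0)]"] normalizes_f[of "[(True, 1)]"] by (simp_all add: f_def)
  show zv: "normalizes z A3" "normalizes v A3"
    using z_A3 v_A3 by (simp_all add: normalizes_def commutes_conjD commutes_iff_conj[THEN iffD1])
  \<comment> \<open>\<open>z\<close> and \<open>v\<close> were chosen so that these two elements
    factor through the centralizer of \<open>A3\<close> and \<open>p0\<close>.\<close>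
  have "x + x + x = z + p0" "p1 = z + - v"
    by (simp_all only: z v group_norm)
  then show "normalizes (x + x + x) A3" "normalizes p1 A3"
    using * zv by (simp_all only: normalizes_add normalizes_minus)
qed

lemma conj_x_p0: "gconj x p0 = p1" and conj_x_pm: "gconj x pm = p0"
  by (simp_all only: p0 pm p1 gconj_def group_norm)

lemma normalizes_zpow: "normalizes g B \<Longrightarrow> normalizes (zpow g n) B"
  by (induction n rule: int_induct[of _ 0])
     (simp_all add: zpow_succ zpow_pred normalizes_add normalizes_minus normalizes_0)

text \<open>Conjugation by \<open>x\<close> turns \<open>p0\<close> into \<open>p1 = z - v\<close>,
  which centralizes \<open>A3\<close>, and \<open>pm\<close> into \<open>p0\<close>. Hence only the
  y-letters of \<open>u\<close> are felt.\<close>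

lemma conj_conj_x_f: "a \<in> A3 \<Longrightarrow> gconj (gconj x (f u)) a = gconj (zpow p0 (- ey u)) a"
proof (induction u)
  case (Cons l u)
  define n where "n = - ey u"
  define b where "b = gconj (zpow p0 n) a"
  have "b \<in> A3"
    using Cons.prems normalizes_zpow[OF normalizes_A3(1)] by (auto simp: normalizes_def b_def)
  have "p1 = z + - v" by (simp only: v group_norm)
  then have "commutes b p1"
    using z_A3[OF \<open>b \<in> A3\<close>] v_A3[OF \<open>b \<in> A3\<close>] by (simp only: commutes_add commutes_minus commutes_sym)
  then have p1b: "gconj p1 b = b" "gconj (- p1) b = b"
    using commutes_sym[of b p1] by (simp_all add: commutes_conjD flip: commutes_iff_conj)
  have "- ey (l # u) = (if snd l = 0 then n else (if fst l then n + 1 else n - 1))"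
    by (simp add: ey_def n_def)
  then have "gconj (zpow p0 (- ey (l # u))) a
      = (if snd l = 0 then b else (if fst l then gconj p0 b else gconj (- p0) b))"
    by (simp add: zpow_succ zpow_pred b_def conj_plus)
  moreover have "gconj (gconj x (f (l # u))) a
      = gconj (if snd l = 0 then (if fst l then - p1 else p1) else (if fst l then p0 else - p0)) b"
    using Cons.IH[OF Cons.prems]
    by (simp add: f_def conj_add conj_minus conj_x_p0 conj_x_pm b_def n_def conj_plus)
  ultimately show ?case by (simp add: p1b)
qed (simp add: f_def ey_def)

section \<open>The three commuting conjugates of \<open>A3\<close> and their product\<close>

lemma commutes_A3_A2: assumes "a \<in> A3" "b \<in> A3" shows "commutes a (gconj x b)"
proof -
  obtain u where "b = f u" "ey u = 0" using \<open>b \<in> A3\<close> by (rule A3_E)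
  then have "commutes (gconj x b) a" using conj_conj_x_f[OF \<open>a \<in> A3\<close>, of u] by (simp add: commutes_iff_conj)
  then show ?thesis by (rule commutes_sym)
qed

lemma commutes_A2_A1: "a \<in> A3 \<Longrightarrow> b \<in> A3 \<Longrightarrow> commutes (gconj x a) (gconj (x + x) b)"
  using commutes_A3_A2 by (simp add: commutes_conj_iff conj_plus)

text \<open>After conjugation by \<open>x\<close> the second element is an
  \<open>x + x + x\<close>-conjugate, which stays in \<open>A3\<close>; so the pair becomes one from
  coordinates 2 and 3.\<close>

lemma commutes_A3_A1: "a \<in> A3 \<Longrightarrow> b \<in> A3 \<Longrightarrow> commutes a (gconj (x + x) b)"
proof -
  assume "a \<in> A3" "b \<in> A3"
  then have "commutes (gconj x a) (gconj (x + x + x) b)"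
    using normalizes_A3(5) commutes_A3_A2[of "gconj (x + x + x) b" a]
    by (simp add: commutes_sym normalizes_def)
  then have "commutes (gconj x a) (gconj x (gconj (x + x) b))" by (simp add: conj_conj add.assoc)
  then show ?thesis by (simp only: commutes_conj_iff)
qed

text \<open>The factors stand in the order used by \<open>assemble\<close>, so that elements of
  \<open>A\<close> are values of assembled words.\<close>

definition A :: "'g set" where
  "A = {a + gconj x b + gconj (x + x) d | a b d. a \<in> A3 \<and> b \<in> A3 \<and> d \<in> A3}"

lemma A_I: "a \<in> A3 \<Longrightarrow> b \<in> A3 \<Longrightarrow> d \<in> A3 \<Longrightarrow> a + gconj x b + gconj (x + x) d \<in> A"
  by (auto simp: A_def)

lemma A3_in_A: "a \<in> A3 \<Longrightarrow> a \<in> A"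
  using A_I[of a 0 0] by (simp add: A3_0)

lemma A2_in_A: "a \<in> A3 \<Longrightarrow> gconj x a \<in> A"
  using A_I[of 0 a 0] by (simp add: A3_0)

lemma A1_in_A: "a \<in> A3 \<Longrightarrow> gconj (x + x) a \<in> A"
  using A_I[of 0 0 a] by (simp add: A3_0)

lemma A_add: "g \<in> A \<Longrightarrow> h \<in> A \<Longrightarrow> g + h \<in> A"
proof -
  assume "g \<in> A" "h \<in> A"
  then obtain a b d a' b' d' where g: "g = a + gconj x b + gconj (x + x) d"
    and h: "h = a' + gconj x b' + gconj (x + x) d'"
    and in_A3: "a \<in> A3" "b \<in> A3" "d \<in> A3" "a' \<in> A3" "b' \<in> A3" "d' \<in> A3"
    by (auto simp: A_def)
  have 1: "gconj (x + x) d + (a' + gconj x b') = (a' + gconj x b') + gconj (x + x) d"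
    using commutes_add[of "gconj (x + x) d" a' "gconj x b'"] in_A3
      commutes_sym[OF commutes_A3_A1[of a' d]] commutes_sym[OF commutes_A2_A1[of b' d]]
    by (simp add: commutes_def)
  have 2: "gconj x b + a' = a' + gconj x b"
    using commutes_A3_A2[of a' b] in_A3 by (simp add: commutes_def)
  have "g + h = a + gconj x b + (gconj (x + x) d + (a' + gconj x b')) + gconj (x + x) d'"
    by (simp add: g h add.assoc)
  also have "\<dots> = a + (gconj x b + a') + gconj x b' + gconj (x + x) d + gconj (x + x) d'"
    by (simp only: 1 add.assoc)
  also have "\<dots> = (a + a') + (gconj x b + gconj x b') + (gconj (x + x) d + gconj (x + x) d')"
    by (simp only: 2 add.assoc)
  finally have "g + h = (a + a') + (gconj x b + gconj x b') + (gconj (x + x) d + gconj (x + x) d')" .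
  then show ?thesis using in_A3 by (simp add: A3_add A_I flip: conj_add)
qed

lemma A_minus: "g \<in> A \<Longrightarrow> - g \<in> A"
proof -
  assume "g \<in> A"
  then obtain a b d where g: "g = a + gconj x b + gconj (x + x) d" and "a \<in> A3" "b \<in> A3" "d \<in> A3"
    by (auto simp: A_def)
  then have "gconj (x + x) (- d) + (gconj x (- b) + - a) \<in> A"
    by (intro A_add A1_in_A A2_in_A A3_in_A A3_minus)
  then show ?thesis by (simp add: g minus_add conj_minus)
qed

lemma normalizes_AI:
  assumes "\<And>a. a \<in> A3 \<Longrightarrow> gconj g a \<in> A \<and> gconj (- g) a \<in> A"
    and "\<And>a. a \<in> A3 \<Longrightarrow> gconj g (gconj x a) \<in> A \<and> gconj (- g) (gconj x a) \<in> A"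
    and "\<And>a. a \<in> A3 \<Longrightarrow> gconj g (gconj (x + x) a) \<in> A \<and> gconj (- g) (gconj (x + x) a) \<in> A"
  shows "normalizes g A"
  unfolding normalizes_def
proof
  fix h assume "h \<in> A"
  then obtain a b d where "h = a + gconj x b + gconj (x + x) d" "a \<in> A3" "b \<in> A3" "d \<in> A3"
    by (auto simp: A_def)
  then show "gconj g h \<in> A \<and> gconj (- g) h \<in> A"
    using assms by (simp add: conj_add A_add)
qed

lemma A3_conj_t: "a \<in> A3 \<Longrightarrow> gconj (x + x + x) a \<in> A3" "a \<in> A3 \<Longrightarrow> gconj (- (x + x + x)) a \<in> A3"
  using normalizes_A3(5) by (auto simp: normalizes_def)

lemma normalizes_x: "normalizes x A"
proof (rule normalizes_AI)
  fix a assume a: "a \<in> A3"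
  \<comment> \<open>The cycle of coordinates closes up only to within x^3, which normalizes
    \<open>A3\<close>.\<close>
  have "gconj (- x) a = gconj (x + x) (gconj (- (x + x + x)) a)"
    by (simp only: gconj_def group_norm)
  then show "gconj x a \<in> A \<and> gconj (- x) a \<in> A" using a A3_conj_t by (simp only: A1_in_A A2_in_A)
  show "gconj x (gconj x a) \<in> A \<and> gconj (- x) (gconj x a) \<in> A"
    using a by (simp add: A1_in_A A3_in_A conj_conj[of x x])
  have "gconj x (gconj (x + x) a) = gconj (x + x + x) a" "gconj (- x) (gconj (x + x) a) = gconj x a"
    by (simp_all only: gconj_def group_norm)
  then show "gconj x (gconj (x + x) a) \<in> A \<and> gconj (- x) (gconj (x + x) a) \<in> A"
    using a A3_conj_t by (simp only: A2_in_A A3_in_A)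
qed

lemma normalizes_p0: "normalizes p0 A"
proof (rule normalizes_AI)
  fix a assume a: "a \<in> A3"
  show "gconj p0 a \<in> A \<and> gconj (- p0) a \<in> A"
    using a normalizes_A3(1) by (auto simp: normalizes_def A3_in_A)
  have "gconj p0 (gconj x a) = gconj x (gconj pm a)" "gconj (- p0) (gconj x a) = gconj x (gconj (- pm) a)"
    unfolding conj_x_pm[symmetric] by (simp_all only: gconj_def group_norm)
  then show "gconj p0 (gconj x a) \<in> A \<and> gconj (- p0) (gconj x a) \<in> A"
    using a normalizes_A3(2) by (auto simp: normalizes_def A2_in_A)
  \<comment> \<open>This is x^-2 p_0 x^2, written through two elements already known to normalize
    \<open>A3\<close>.\<close>
  define q where "q = - (x + x + x) + p1 + (x + x + x)"
  have "normalizes q A3"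
    unfolding q_def by (intro normalizes_add normalizes_minus normalizes_A3)
  moreover have "gconj p0 (gconj (x + x) a) = gconj (x + x) (gconj q a)"
    "gconj (- p0) (gconj (x + x) a) = gconj (x + x) (gconj (- q) a)"
    unfolding q_def p1 by (simp_all only: gconj_def group_norm)
  ultimately show "gconj p0 (gconj (x + x) a) \<in> A \<and> gconj (- p0) (gconj (x + x) a) \<in> A"
    using a by (auto simp: normalizes_def A1_in_A)
qed

lemma normalizes_y: "normalizes y A"
proof -
  have "y = - p0 + x" by (simp only: p0 group_norm)
  then show ?thesis by (simp only: normalizes_add normalizes_minus normalizes_x normalizes_p0)
qed

lemma normalizes_wev: "normalizes (wev (\<lambda>k. if k = 0 then x else y) w) A"
  by (induction w) (auto intro!: normalizes_add normalizes_minus normalizes_x normalizes_y normalizes_0)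

section \<open>Commutators that vanish modulo \<open>A\<close>\<close>

lemma comm_p0_pm: "comm p0 pm \<in> A3"
proof -
  \<comment> \<open>The word is the commutator of x and y^-1, since \<open>f\<close> sends y^-1 to
    \<open>pm\<close>.\<close>
  have "comm p0 pm = f [(False, 0), (True, 1), (True, 0), (False, 1)]"
    by (simp only: f_def comm_def wev.simps group_norm) simp
  then show ?thesis unfolding A3_def by (auto simp: ex_def ey_def)
qed

text \<open>From \<open>x + x + x = z + p0\<close> and \<open>z = p1 + v\<close>, where
  \<open>v\<close> commutes with \<open>p0\<close>, only [p_1, p_0] remains, the
  \<open>x\<close>-conjugate of [p_0, p_-1].\<close>

lemma comm_t_p0: "comm (x + x + x) p0 \<in> A"
proof -
  have "x + x + x = z + p0" by (simp only: z group_norm)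
  then have "comm (x + x + x) p0 = comm z p0" by (simp only: comm_def group_norm)
  also have "z = p1 + v" by (simp only: v group_norm)
  also have "comm (p1 + v) p0 = comm p1 p0"
    using v_p0 by (simp add: comm_eq_conj commutes_iff_conj conj_plus)
  also have "\<dots> = gconj x (comm p0 pm)" by (simp add: conj_comm conj_x_p0 conj_x_pm)
  finally show ?thesis using comm_p0_pm by (simp add: A2_in_A)
qed

lemma comm_t_pm: "comm (x + x + x) pm \<in> A"
proof -
  have "x + x + x = z + p0" by (simp only: z group_norm)
  then have "comm (x + x + x) pm = gconj z (comm p0 pm) + comm z pm"
    by (simp only: comm_def gconj_def group_norm)
  also have "comm z pm = 0" using z_pm by (simp add: comm_eq_0_iff)
  finally show ?thesis
    using comm_p0_pm normalizes_A3(3) by (auto simp: normalizes_def A3_in_A)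
qed

lemma A_conj_x: "a \<in> A \<Longrightarrow> gconj x a \<in> A"
  using normalizes_x by (simp add: normalizes_def)

lemma comm_t_p1: "comm (x + x + x) p1 \<in> A"
proof -
  have "comm (x + x + x) p1 = gconj x (comm (x + x + x) p0)"
    unfolding conj_x_p0[symmetric] by (simp only: comm_def gconj_def group_norm)
  then show ?thesis using A_conj_x comm_t_p0 by simp
qed

lemma comm_p1_p0: "comm p1 p0 \<in> A"
  using A2_in_A[OF comm_p0_pm] by (simp add: conj_comm conj_x_p0 conj_x_pm)

lemma comm_p1_tpm: "comm (gconj (x + x + x) pm) p1 \<in> A"
proof -
  \<comment> \<open>Both sides are p_2, so the commutator is the \<open>x\<close>-conjugate of
    [p_1, p_0].\<close>
  have "gconj (x + x + x) pm = gconj x p1"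
    unfolding conj_x_p0[symmetric] conj_x_pm[symmetric] by (simp only: gconj_def group_norm)
  then show ?thesis using A_conj_x[OF comm_p1_p0] by (simp add: conj_comm conj_x_p0)
qed

end

section \<open>Sections of words\<close>

text \<open>
  Conjugating the section of a group element below the vertex \<open>i\<close> by suitable powers of the rooted
  rotation turns the recursion for \<open>x\<close> and \<open>y\<close> (the letters 0 and 1) into
  \<open>x = \<tau> (x, 1, 1)\<close> and \<open>y = \<tau> (1, 1, y)\<close>, where \<open>\<tau>\<close> sends the subtree \<open>i\<close> to \<open>i - 1\<close>. Hence each
  letter of a word occurs in exactly one of its three sections.
\<close>

definition dg :: "nat letter list \<Rightarrow> 3" where
  "dg = wev (\<lambda>_. 1)"

text \<open>\<open>j\<close> is the vertex at which the letter is applied: x acts at 1 and y at 0.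
  An inverse letter moves \<open>j\<close> to \<open>j + 1\<close>, and its section at
  \<open>j\<close> inverts that of the generator at \<open>j + 1\<close>.\<close>

definition active :: "nat letter \<Rightarrow> 3 \<Rightarrow> bool" where
  "active l j \<longleftrightarrow> (if fst l then j + 1 else j) = (if snd l = 0 then 1 else 0)"

text \<open>Letters act from the right, so \<open>l\<close> meets the vertex \<open>i\<close> after
  it has been moved to \<open>i - dg w\<close>.\<close>

fun sect :: "3 \<Rightarrow> nat letter list \<Rightarrow> nat letter list" where
  "sect i [] = []"
| "sect i (l # w) = (if active l (i - dg w) then [l] else []) @ sect i w"

lemma exhaust_3: "(i :: 3) = 0 \<or> i = 1 \<or> i = 2"
proof (induction i)
  case (of_int m)
  then have "m = 0 \<or> m = 1 \<or> m = 2" by fastforce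
  then show ?case by auto
qed

lemma all_3: "(\<forall>i :: 3. P i) \<longleftrightarrow> P 0 \<and> P 1 \<and> P 2"
  using exhaust_3 by metis

lemma dg_simps [simp]: "dg [] = 0" "dg (u @ v) = dg u + dg v" "dg (winv u) = - dg u"
    "dg (reduce u) = dg u" "dg (l # u) = (if fst l then - 1 else 1) + dg u"
  by (simp_all add: dg_def)

lemma ex_simps [simp]: "ex [] = 0" "ex (u @ v) = ex u + ex v" "ex (winv u) = - ex u"
    "ex (reduce u) = ex u"
    "ex (l # u) = (if snd l = 0 then if fst l then - 1 else 1 else 0) + ex u"
  by (simp_all add: ex_def)

lemma ey_simps [simp]: "ey [] = 0" "ey (u @ v) = ey u + ey v" "ey (winv u) = - ey u"
    "ey (reduce u) = ey u"
    "ey (l # u) = (if snd l = 0 then 0 else if fst l then - 1 else 1) + ey u"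
  by (simp_all add: ey_def)

lemma dg_eq: "dg w = of_int (ex w + ey w)"
  by (induction w) auto

lemma sect_append: "sect i (u @ v) = sect (i - dg v) u @ sect i v"
  by (induction u) (simp_all add: algebra_simps)

lemma active_inv_letter: "active (inv_letter l) i \<longleftrightarrow> active l (i + dg [l])"
  by (auto simp: active_def inv_letter_def)

lemma sect_winv: "sect i (winv w) = winv (sect (i + dg w) w)"
proof (induction w arbitrary: i)
  case (Cons l w)
  have 1: "i - dg [inv_letter l] + dg w = i + dg (l # w)"
    by (auto simp: inv_letter_def)
  have 2: "i + dg [l] = i + dg (l # w) - dg w" by simp
  have "sect (i - dg [inv_letter l]) (winv w) = winv (sect (i + dg (l # w)) w)"
    and "active (inv_letter l) i = active l (i + dg (l # w) - dg w)"
    by (simp_all only: Cons 1 active_inv_letter 2)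
  then show ?case
    by (simp add: winv_Cons winv_append sect_append del: dg_simps(5))
qed simp

lemma reduce_sect_push: "reduce (sect i (push l w)) = reduce (sect i (l # w))"
proof (cases "w \<noteq> [] \<and> hd w = inv_letter l")
  case True
  then obtain w' where w: "w = inv_letter l # w'" by (cases w) auto
  have "sect i (l # w) = sect (i - dg w') ([l] @ winv [l]) @ sect i w'"
    by (simp add: w winv_Cons algebra_simps)
  moreover have "reduce (sect j ([l] @ winv [l])) = reduce []" for j
    unfolding sect_append sect_winv by simp
  ultimately have "reduce (sect i (l # w)) = reduce ([] @ sect i w')"
    by (metis reduce_append_cong)
  then show ?thesis by (simp add: w)
qed (cases w; auto)

lemma reduce_sect_reduce [simp]: "reduce (sect i (reduce w)) = reduce (sect i w)"
proof (induction w)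
  case (Cons l w)
  have "reduce (sect i (reduce (l # w))) = reduce (sect (i - dg w) [l] @ sect i (reduce w))"
    by (simp add: reduce_Cons reduce_sect_push)
  also have "\<dots> = reduce (sect (i - dg w) [l] @ sect i w)" using Cons by (metis reduce_append_cong)
  finally show ?case by simp
qed simp

lemma active_cases: "active l j \<longleftrightarrow> j = (if snd l = 0 then 1 else 0) - (if fst l then 1 else 0)"
  by (auto simp: active_def eq_diff_eq)

lemma sum_sect:
  fixes h :: "nat letter list \<Rightarrow> 'n::comm_monoid_add"
  assumes "h [] = 0" "\<And>l w. h (l # w) = h [l] + h w"
  shows "h (sect 0 w) + h (sect 1 w) + h (sect 2 w) = h w"
proof (induction w)
  case (Cons l w)
  \<comment> \<open>For each letter exactly one of the three vertices is active.\<close>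
  have "(active l (0 - dg w) \<and> \<not> active l (1 - dg w) \<and> \<not> active l (2 - dg w)) \<or>
    (\<not> active l (0 - dg w) \<and> active l (1 - dg w) \<and> \<not> active l (2 - dg w)) \<or>
    (\<not> active l (0 - dg w) \<and> \<not> active l (1 - dg w) \<and> active l (2 - dg w))"
    using exhaust_3[of "dg w"] by (cases l) (auto simp: active_cases)
  moreover have "h (l # w) = h [l] + (h (sect 0 w) + h (sect 1 w) + h (sect 2 w))"
    using assms(2)[of l w] Cons by simp
  moreover have "h (l # sect i w) = h [l] + h (sect i w)" for i using assms(2) .
  ultimately show ?case by (auto simp: ac_simps)
qed (simp add: assms(1))

lemma ex_sect: "ex (sect 0 w) + ex (sect 1 w) + ex (sect 2 w) = ex w"
  and ey_sect: "ey (sect 0 w) + ey (sect 1 w) + ey (sect 2 w) = ey w"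
  by (rule sum_sect; simp)+

lemma letters_sect: "snd ` set (sect i w) \<subseteq> snd ` set w"
  by (induction w) auto

text \<open>In a reduced word, consecutive letters entering the same section number at most two: the
  only such pairs are yx and its inverse. Hence every section misses one of the first three
  letters.\<close>

lemma length_sect_less:
  assumes "reduced w" "snd ` set w \<subseteq> {0, 1}" "3 \<le> length w"
  shows "length (sect i w) < length w"
proof -
  obtain l1 l2 l3 u where w: "w = l1 # l2 # l3 # u"
    using assms(3) by (auto simp: numeral_3_eq_3 Suc_le_length_iff)
  have "length (sect i u) \<le> length u" by (induction u) auto
  moreover have "\<not> (active l3 j \<and> active l2 (j - dg [l3]) \<and> active l1 (j - dg [l2, l3]))" for j
    using assms(1,2) exhaust_3[of j]
    by (cases l1; cases l2; cases l3) (auto simp: w active_cases reduced_Cons inv_letter_def)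
  from this[of "i - dg u"]
  have "\<not> (active l3 (i - dg u) \<and> active l2 (i - dg (l3 # u)) \<and> active l1 (i - dg (l2 # l3 # u)))"
    by (simp add: algebra_simps)
  ultimately show ?thesis by (auto simp: w simp del: dg_simps)
qed

lemma numeral_3_eq_0: "(3 :: 3) = 0"
  by simp

lemma of_int_3_eq: "(of_int r :: 3) = of_int (r mod 3)"
proof -
  have "(of_int r :: 3) = of_int (3 * (r div 3) + r mod 3)" by simp
  also have "\<dots> = 0 * of_int (r div 3) + of_int (r mod 3)"
    unfolding of_int_add of_int_mult of_int_numeral by (subst numeral_3_eq_0) (rule refl)
  finally show ?thesis by simp
qed

lemma zpow_succ_right: "zpow g (n + 1) = zpow g n + g"
  using commutes_zpow[OF commutes_self, of g n] by (simp add: zpow_succ commutes_def)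

lemma zpow_pred_right: "zpow g (n - 1) = zpow g n - g"
  using zpow_succ_right[of g "n - 1"] by simp

text \<open>
  Modulo the commutator subgroups of the three coordinates, the group is an extension of the free
  abelian group on \<open>pm\<close>, \<open>p0\<close>, \<open>p1\<close> by \<open>\<langle>x\<rangle>\<close>, and the exponents are read off the sections.
\<close>

lemma abelian_normal_form:
  fixes c :: "nat \<Rightarrow> 'g::group_add"
  assumes p0: "p0 = c 0 - c 1" and pm: "pm = - c 1 + c 0" and p1: "p1 = gconj (c 0) p0"
    and comm: "commutes pm p0" "commutes pm p1" "commutes p0 p1"
    and t: "commutes (c 0 + c 0 + c 0) p1"
    and w: "snd ` set w \<subseteq> {0, 1}"
  shows "wev c w = zpow (c 0) (ex w + ey w) + zpow pm (- ey (sect 0 w)) + zpow p0 (- ey (sect 2 w))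
    + zpow p1 (- ey (sect 1 w))"
proof -
  define x where "x = c 0"
  define q where "q r = gconj (- zpow x r) p0" for r
  have x_pm: "gconj x pm = p0" and x_p0: "gconj x p0 = p1"
    unfolding p0 pm p1 x_def by (simp_all only: gconj_def group_norm)
  \<comment> \<open>As x^3 commutes with \<open>p1\<close>, conjugation by \<open>x\<close> permutes
    \<open>pm\<close>, \<open>p0\<close>, \<open>p1\<close> cyclically.\<close>
  have "gconj (x + x + x) (gconj x p1) = gconj (x + x + x) pm"
  proof -
    have "gconj (x + x + x) (gconj x p1) = gconj x (gconj (x + x + x) p1)"
      by (simp only: gconj_def group_norm)
    also have "\<dots> = gconj x p1" using t by (simp add: x_def commutes_iff_conj)
    also have "\<dots> = gconj (x + x + x) pm" by (simp add: conj_plus x_p0 x_pm)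
    finally show ?thesis .
  qed
  then have x_p1: "gconj x p1 = pm" by (metis conj_minus_self(1))
  have q: "q r = (if r mod 3 = 0 then p0 else if r mod 3 = 1 then pm else p1)" for r
  proof (induction r rule: int_induct[of _ 0])
    case (step1 r)
    have "q (r + 1) = gconj (- x) (q r)"
      unfolding q_def zpow_succ_right by (simp only: gconj_def group_norm)
    moreover have "(r + 1) mod 3 = (if r mod 3 = 2 then 0 else r mod 3 + 1)" "r mod 3 < 3" "0 \<le> r mod 3"
      by presburger+
    ultimately show ?case
      using step1 x_pm x_p0 x_p1 by (auto simp: conj_minus_eqI)
  next
    case (step2 r)
    have "q (r - 1) = gconj x (q r)"
      unfolding q_def zpow_pred_right by (simp only: gconj_def group_norm)
    moreover have "(r - 1) mod 3 = (if r mod 3 = 0 then 2 else r mod 3 - 1)" "r mod 3 < 3" "0 \<le> r mod 3"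
      by presburger+
    ultimately show ?case
      using step2 x_pm x_p0 x_p1 by (auto simp: conj_minus_eqI)
  qed (simp add: q_def)
  \<comment> \<open>The exponents are visible in the sections: \<open>pm\<close>, \<open>p0\<close>,
    \<open>p1\<close> contain one y^-1 each, in section 0, 2, 1 respectively, while x contains no
    y.\<close>
  define NF where "NF r i j k = zpow x r + zpow pm i + zpow p0 j + zpow p1 k" for r i j k
  have NF: "p0 + NF r i j k = NF r (if r mod 3 = 1 then i + 1 else i)
    (if r mod 3 = 0 then j + 1 else j) (if r mod 3 = 2 then k + 1 else k)" for r i j k
  proof -
    have "p0 + zpow x r = zpow x r + q r" by (simp only: q_def gconj_def group_norm)
    then have *: "p0 + NF r i j k = zpow x r + (q r + zpow pm i + zpow p0 j + zpow p1 k)"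
      by (simp add: NF_def flip: add.assoc)
    have "p0 + zpow pm i = zpow pm i + p0" "p1 + zpow pm i = zpow pm i + p1"
        "p1 + zpow p0 j = zpow p0 j + p1"
      using comm commutes_zpow commutes_sym by (metis commutes_def)+
    then have "p0 + zpow pm i + zpow p0 j = zpow pm i + zpow p0 (j + 1)"
        "p1 + zpow pm i + zpow p0 j + zpow p1 k = zpow pm i + zpow p0 j + zpow p1 (k + 1)"
      by (simp_all only: add.assoc zpow_succ)
    then have "q r + zpow pm i + zpow p0 j + zpow p1 k = zpow pm (if r mod 3 = 1 then i + 1 else i)
        + zpow p0 (if r mod 3 = 0 then j + 1 else j) + zpow p1 (if r mod 3 = 2 then k + 1 else k)"
      using pos_mod_bound[of 3 r] pos_mod_sign[of 3 r] by (auto simp: q zpow_succ)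
    then show ?thesis unfolding * by (simp add: NF_def add.assoc)
  qed
  have NF': "- p0 + NF r i j k = NF r (if r mod 3 = 1 then i - 1 else i)
    (if r mod 3 = 0 then j - 1 else j) (if r mod 3 = 2 then k - 1 else k)" for r i j k
  proof -
    have "NF r i j k = p0 + NF r (if r mod 3 = 1 then i - 1 else i)
        (if r mod 3 = 0 then j - 1 else j) (if r mod 3 = 2 then k - 1 else k)"
      unfolding NF by simp
    then show ?thesis by (simp only: minus_add_cancel)
  qed
  have x: "x + NF r i j k = NF (r + 1) i j k" "- x + NF r i j k = NF (r - 1) i j k" for r i j k
    by (simp_all add: NF_def zpow_succ zpow_pred add.assoc)
  have y: "c 1 = - p0 + x" "- c 1 = - x + p0"
    unfolding p0 x_def by (simp_all only: group_norm)
  have "wev c w = NF (ex w + ey w) (- ey (sect 0 w)) (- ey (sect 2 w)) (- ey (sect 1 w))"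
    using w
  proof (induction w)
    case (Cons l w)
    define r where "r = ex w + ey w"
    define a b where "a = r mod 3" and "b = (r + 1) mod 3"
    have ab: "a = 0 \<and> b = 1 \<or> a = 1 \<and> b = 2 \<or> a = 2 \<and> b = 0"
      unfolding a_def b_def by presburger
    have dg: "dg w = of_int a" using of_int_3_eq by (simp add: dg_eq r_def a_def)
    have IH: "wev c w = NF r (- ey (sect 0 w)) (- ey (sect 2 w)) (- ey (sect 1 w))"
      using Cons by (simp add: r_def)
    consider "l = (False, 0)" | "l = (True, 0)" | "l = (False, 1)" | "l = (True, 1)"
      using Cons.prems by (cases l) auto
    then show ?case
    proof cases
      case 3
      \<comment> \<open>Write y as p_0^-1 x. Moving p_0 past x^(r+1) gives \<open>pm\<close>,
        \<open>p1\<close>, \<open>p0\<close> for r = 0, 1, 2 modulo 3, matching the section r modulo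
        3 in which this y is active.\<close>
      have "wev c (l # w) = - p0 + NF (r + 1) (- ey (sect 0 w)) (- ey (sect 2 w)) (- ey (sect 1 w))"
        using 3 by (simp add: IH y[unfolded One_nat_def] x add.assoc)
      moreover have "ex (l # w) + ey (l # w) = r + 1" using 3 by (simp add: r_def)
      moreover have "- ey (sect i (l # w)) = (if i = of_int a then - ey (sect i w) - 1 else - ey (sect i w))" for i
        using 3 by (simp add: active_def dg)
      ultimately show ?thesis
        using ab by (elim disjE conjE) (simp_all only: NF'[of "r + 1", folded b_def], simp_all)
    next
      case 4
      have "wev c (l # w) = - x + (p0 + NF r (- ey (sect 0 w)) (- ey (sect 2 w)) (- ey (sect 1 w)))"
        using 4 by (simp add: IH) (simp only: y(2)[unfolded One_nat_def] add.assoc)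
      moreover have "ex (l # w) + ey (l # w) = r - 1" using 4 by (simp add: r_def)
      moreover have "- ey (sect i (l # w)) = (if i + 1 = of_int a then - ey (sect i w) + 1 else - ey (sect i w))" for i
        using 4 by (simp add: active_def dg algebra_simps)
      ultimately show ?thesis
        using ab by (elim disjE conjE) (simp_all only: NF[of r, folded a_def] x, simp_all)
    qed (simp_all add: IH r_def flip: x_def add: x, simp_all add: algebra_simps)
  qed (simp add: NF_def)
  then show ?thesis by (simp add: NF_def x_def)
qed

section \<open>Words with trivial sections\<close>

lemma normal_closure_normal:
  assumes "group G" "X \<subseteq> carrier G"
  shows "normal_closure G X \<lhd> G"
proof -
  interpret group G by (rule assms)
  let ?F = "{N. N \<lhd> G \<and> X \<subseteq> N}"
  have "carrier G \<lhd> G" by (intro normal_invI subgroup_self) simp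
  then have "carrier G \<in> ?F" using assms by simp
  then have "subgroup (\<Inter>?F) G" by (intro subgroups_Inter) (auto intro: normal_imp_subgroup)
  then show ?thesis
    unfolding normal_closure_def by (rule normal_invI) (auto intro: normal.inv_op_closed2)
qed

lemma normal_closure_subset: "X \<subseteq> normal_closure G X"
  by (auto simp: normal_closure_def)

lemma normal_closure_minimal: "N \<lhd> G \<Longrightarrow> X \<subseteq> N \<Longrightarrow> normal_closure G X \<subseteq> N"
  by (auto simp: normal_closure_def)

lemma reduce_append_Nil [simp]:
  "reduce u = [] \<Longrightarrow> reduce (u @ v) = reduce v" "reduce v = [] \<Longrightarrow> reduce (u @ v) = reduce u"
  using reduce_append_left[of u v] reduce_append_right[of u v] by simp_all

lemma reduce_winv_Nil [simp]: "reduce (winv u) = [] \<longleftrightarrow> reduce u = []"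
  using reduce_winv[of u] reduce_winv[of "winv u"] by auto

section \<open>The seven relators as words\<close>

definition gen :: "nat \<Rightarrow> nat letter list" where
  "gen k = [(False, k)]"

definition wcomm :: "'a letter list \<Rightarrow> 'a letter list \<Rightarrow> 'a letter list" where
  "wcomm u v = u @ v @ winv u @ winv v"

definition "word_p0 = gen 0 @ winv (gen 1)"
definition "word_pm = winv (gen 1) @ gen 0"
definition "word_p1 = gen 0 @ word_p0 @ winv (gen 0)"
definition "word_z = gen 0 @ gen 0 @ gen 0 @ winv word_p0"
definition "word_v = winv word_p1 @ word_z"
definition "word_d = wcomm word_z word_p0"
definition "word_k = wcomm word_pm word_v"

text \<open>These are the last seven assumptions of \<open>relations\<close>, in the same
  order.\<close>

definition base_words :: "nat letter list set" where
  "base_words = {wcomm word_v word_p0, wcomm word_z word_pm, wcomm word_k word_p0,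
     wcomm word_d word_pm, wcomm word_k word_d, wcomm (word_v @ word_p0) word_d,
     wcomm (word_z @ winv word_pm) word_k}"

lemmas word_defs = word_p0_def word_pm_def word_p1_def word_z_def word_v_def word_d_def word_k_def

lemma wev_wcomm: "wev c (wcomm u v) = comm (wev c u) (wev c v)"
  by (simp only: wcomm_def comm_def wev_append wev_winv group_norm)

lemma dg_wcomm [simp]: "dg (wcomm u v) = 0"
  by (simp add: wcomm_def)

lemma sect_wcomm: "dg u = 0 \<Longrightarrow> dg v = 0 \<Longrightarrow> sect i (wcomm u v) = wcomm (sect i u) (sect i v)"
  by (simp add: wcomm_def sect_append sect_winv)

lemma reduce_wcomm_Nil: "reduce u = [] \<or> reduce v = [] \<Longrightarrow> reduce (wcomm u v) = []"
proof (elim disjE)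
  assume "reduce u = []"
  then have "reduce (wcomm u v) = reduce ([] @ v @ [] @ winv v)"
    unfolding wcomm_def by (intro reduce_append_cong) simp_all
  then show "reduce (wcomm u v) = []" by simp
next
  assume "reduce v = []"
  then have "reduce (wcomm u v) = reduce (u @ [] @ winv u @ [])"
    unfolding wcomm_def by (intro reduce_append_cong) simp_all
  then show "reduce (wcomm u v) = []" by simp
qed

lemma reduce_wcomm_eq: "reduce u = reduce v \<or> reduce u = reduce (winv v) \<Longrightarrow> reduce (wcomm u v) = []"
proof -
  have *: "reduce (wcomm u v) = reduce (u' @ v @ winv u' @ winv v)" if "reduce u = reduce u'" for u'
    using that reduce_winv[of u] reduce_winv[of u']
    unfolding wcomm_def by (intro reduce_append_cong) simp_all
  have "reduce (v @ (v @ winv v) @ winv v) = reduce (v @ [] @ winv v)"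
    by (intro reduce_append_cong) simp_all
  then have "reduce (v @ v @ winv v @ winv v) = []" by simp
  moreover have "reduce ((winv v @ v) @ v @ winv v) = []"
    by (subst reduce_append_Nil) simp_all
  ultimately show "reduce u = reduce v \<or> reduce u = reduce (winv v) \<Longrightarrow> reduce (wcomm u v) = []"
    using *[of v] *[of "winv v"] by auto
qed

lemma letters_wcomm [simp]: "snd ` set (wcomm u v) = snd ` set u \<union> snd ` set v"
  by (auto simp: wcomm_def image_Un)

lemma dg_words [simp]: "dg word_p0 = 0" "dg word_pm = 0" "dg word_p1 = 0" "dg word_z = 0"
    "dg word_v = 0" "dg word_d = 0" "dg word_k = 0"
  by (simp_all add: word_defs gen_def)

lemma letters_words [simp]: "snd ` set word_p0 = {0, 1}" "snd ` set word_pm = {0, 1}"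
    "snd ` set word_p1 = {0, 1}" "snd ` set word_z = {0, 1}" "snd ` set word_v = {0, 1}"
    "snd ` set word_d = {0, 1}" "snd ` set word_k = {0, 1}"
  by (auto simp: word_defs gen_def image_Un)

lemma sect_p0: "reduce (sect 0 word_p0) = gen 0" "reduce (sect 1 word_p0) = []"
    "reduce (sect 2 word_p0) = winv (gen 1)"
  and sect_pm: "reduce (sect 0 word_pm) = winv (gen 1)" "reduce (sect 1 word_pm) = gen 0"
    "reduce (sect 2 word_pm) = []"
  and sect_z: "reduce (sect 0 word_z) = []" "reduce (sect 1 word_z) = gen 0"
    "reduce (sect 2 word_z) = gen 0 @ gen 1"
  and sect_v: "reduce (sect 0 word_v) = []" "reduce (sect 1 word_v) = gen 1 @ gen 0"
    "reduce (sect 2 word_v) = gen 1"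
  by (simp_all add: word_defs gen_def winv_def inv_letter_def active_def reduce_def)

lemma sect_d: "reduce (sect 0 word_d) = []" "reduce (sect 1 word_d) = []"
  and sect_k: "reduce (sect 0 word_k) = []" "reduce (sect 2 word_k) = []"
  by (simp_all add: word_d_def word_k_def sect_wcomm reduce_wcomm_Nil sect_p0 sect_pm sect_z sect_v)

lemma letters_base_words: "r \<in> base_words \<Longrightarrow> snd ` set r = {0, 1}"
  unfolding base_words_def
  by (elim insertE emptyE; hypsubst; simp only: letters_wcomm set_append image_Un letters_winv letters_words;
      simp)

lemma dg_base_words: "r \<in> base_words \<Longrightarrow> dg r = 0"
  unfolding base_words_def by (elim insertE emptyE; hypsubst; rule dg_wcomm)

lemma sect_base_words: "r \<in> base_words \<Longrightarrow> reduce (sect i r) = []"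
proof -
  \<comment> \<open>The two mixed relators: \<open>word_v @ word_p0\<close> vanishes in section 2,
    the only one where \<open>word_d\<close> survives, and \<open>word_z @ winv word_pm\<close>
    vanishes in section 1, the only one where \<open>word_k\<close> survives.\<close>
  have vp: "reduce (sect 2 word_v @ sect 2 word_p0) = []"
    using reduce_append_cong[of "sect 2 word_v" "gen 1" "sect 2 word_p0" "winv (gen 1)"] sect_p0 sect_v
    by (simp add: gen_def reduce_def winv_def inv_letter_def)
  have zp: "reduce (sect 1 word_z @ winv (sect 1 word_pm)) = []"
    using reduce_append_cong[of "sect 1 word_z" "gen 0" "winv (sect 1 word_pm)" "winv (gen 0)"]
      reduce_winv[of "sect 1 word_pm"] sect_pm sect_z
    by (simp add: gen_def reduce_def winv_def inv_letter_def)
  have v2: "reduce (sect 2 word_v) = reduce (winv (sect 2 word_p0))"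
    using reduce_winv[of "sect 2 word_p0"] sect_p0 sect_v
    by (simp add: gen_def reduce_def winv_def inv_letter_def)
  have z1: "reduce (sect 1 word_z) = reduce (sect 1 word_pm)" by (simp add: sect_z sect_pm)
  have "reduce (sect 0 r) = [] \<and> reduce (sect 1 r) = [] \<and> reduce (sect 2 r) = []"
    if "r \<in> base_words"
    using that unfolding base_words_def
    by (elim insertE emptyE; hypsubst; simp add: sect_wcomm sect_append sect_winv reduce_wcomm_Nil
        reduce_wcomm_eq sect_d sect_k sect_p0(2) sect_pm(3) sect_z(1) sect_v(1) vp zp v2 z1)
  then show "r \<in> base_words \<Longrightarrow> reduce (sect i r) = []" using exhaust_3[of i] by auto
qed

lemma base_words_carrier: "reduce ` base_words \<subseteq> carrier (free_group {0, 1})"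
proof (rule image_subsetI)
  fix r assume "r \<in> base_words"
  then show "reduce r \<in> carrier (free_group {0, 1})"
    by (intro reduce_in_carrier) (simp only: letters_base_words order_refl)
qed

text \<open>The kernel of the section map from the words of degree 0 to triples of free group
  elements.\<close>

lemma trivial_sections_normal:
  "{w \<in> carrier (free_group S). dg w = 0 \<and> (\<forall>i. reduce (sect i w) = [])} \<lhd> free_group S"
    (is "?M \<lhd> ?F")
proof -
  interpret F: group ?F by (rule group_free_group)
  have inv: "dg (reduce (winv w)) = 0 \<and> reduce (sect i (reduce (winv w))) = []" if "w \<in> ?M" for w i
    using that by (simp add: sect_winv)
  have "subgroup ?M ?F"
  proof (rule F.subgroupI)
    have "[] \<in> ?M" by (simp add: carrier_free_group)
    then show "?M \<noteq> {}" by blast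
    show "inv\<^bsub>?F\<^esub> w \<in> ?M" if "w \<in> ?M" for w
    proof -
      have "inv\<^bsub>?F\<^esub> w \<in> carrier ?F" "inv\<^bsub>?F\<^esub> w = reduce (winv w)"
        using that inv_free_group by auto
      then show ?thesis using inv[OF that] by simp
    qed
    show "u \<otimes>\<^bsub>?F\<^esub> w \<in> ?M" if "u \<in> ?M" "w \<in> ?M" for u w
    proof -
      have "u \<otimes>\<^bsub>?F\<^esub> w \<in> carrier ?F" using that by auto
      then show ?thesis using that by (simp add: mult_free_group sect_append)
    qed
  qed auto
  then show ?thesis
  proof (rule F.normal_invI)
    fix u w assume u: "u \<in> carrier ?F" and w: "w \<in> ?M"
    have "u \<otimes>\<^bsub>?F\<^esub> w \<otimes>\<^bsub>?F\<^esub> inv\<^bsub>?F\<^esub> u \<in> carrier ?F" using u w by auto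
    moreover have "u \<otimes>\<^bsub>?F\<^esub> w \<otimes>\<^bsub>?F\<^esub> inv\<^bsub>?F\<^esub> u = reduce (u @ w @ winv u)"
      using u by (simp add: mult_free_group inv_free_group reduce_append_left reduce_append_right)
    moreover have "reduce (sect i (u @ w @ winv u)) = []" for i
      using w by (auto simp: sect_append sect_winv intro: trans[OF reduce_append_cong[OF refl reduce_append_Nil(1)]])
    ultimately show "u \<otimes>\<^bsub>?F\<^esub> w \<otimes>\<^bsub>?F\<^esub> inv\<^bsub>?F\<^esub> u \<in> ?M" using w by simp
  qed
qed


section \<open>The substitution\<close>

text \<open>The symbol 2, later used for a, also goes to x^-1 y. This default makes
  \<open>\<Phi>\<close> an endomorphism of the free group on three symbols; the relators to which it
  is applied involve only 0 and 1.\<close>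

definition \<sigma> :: "nat \<Rightarrow> nat letter list" where
  "\<sigma> k = (if k = 0 then [(False, 0), (True, 1)] else [(True, 0), (False, 1)])"

lemma \<sigma>_simps [simp]:
  "\<sigma> 0 = [(False, 0), (True, 1)]" "k \<noteq> 0 \<Longrightarrow> \<sigma> k = [(True, 0), (False, 1)]"
  by (simp_all add: \<sigma>_def)

lemma letters_\<sigma>: "snd ` set (wsub \<sigma> w) \<subseteq> {0, 1}"
proof -
  have "snd ` set (\<sigma> k) = {0, 1}" for k by (cases "k = 0") auto
  then show ?thesis by (simp only: letters_wsub) auto
qed

lemma dg_wsub [simp]: "dg (wsub \<sigma> w) = 0"
proof (induction w)
  case (Cons l w)
  then show ?case by (cases "snd l = 0") auto
qed simp

lemma sect_wsub_Cons:
  "sect 0 (wsub \<sigma> (l # w)) = (fst l, if snd l = 0 then 0 else 1) # sect 0 (wsub \<sigma> w)"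
  "sect 1 (wsub \<sigma> (l # w)) = (if snd l = 0 then [] else [(\<not> fst l, 0)]) @ sect 1 (wsub \<sigma> w)"
  "sect 2 (wsub \<sigma> (l # w)) = (if snd l = 0 then [(\<not> fst l, 1)] else []) @ sect 2 (wsub \<sigma> w)"
  by (cases "snd l = 0"; simp add: sect_append active_def winv_def inv_letter_def)+

lemma sect_0_wsub: "snd ` set w \<subseteq> {0, 1} \<Longrightarrow> sect 0 (wsub \<sigma> w) = w"
  by (induction w) (auto simp: sect_wsub_Cons simp del: wsub.simps(2))

lemma sect_0_wsub': "wev (\<lambda>k. if k = 0 then g else h) (sect 0 (wsub \<sigma> w)) = wev (\<lambda>k. if k = 0 then g else h) w"
  by (induction w) (simp_all add: sect_wsub_Cons del: wsub.simps(2))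

lemma reduce_single_generator:
  "snd ` set w \<subseteq> {k} \<Longrightarrow> reduce w = replicate (nat \<bar>wev (\<lambda>_. 1) w\<bar>) (wev (\<lambda>_. 1 :: int) w < 0, k)"
proof (induction w)
  case (Cons l w)
  define n where "n = wev (\<lambda>_. 1 :: int) w"
  have IH: "reduce w = replicate (nat \<bar>n\<bar>) (n < 0, k)" using Cons by (simp add: n_def)
  consider "n = 0" | m where "n = int (Suc m)" | m where "n = - int (Suc m)"
    by (metis int_cases2 nat.exhaust of_nat_0 int_cases minus_zero)
  then show ?case
    using Cons.prems
    by cases (cases l; auto simp: reduce_Cons IH inv_letter_def nat_add_distrib simp flip: n_def)+
qed simp

text \<open>This section involves x alone, so it is a power of x, with exponent
  \<open>- ey w\<close>. Likewise section 2 is a power of y with exponent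
  \<open>- ex w\<close>.\<close>

lemma sect_1_wsub: assumes "ey w = 0" shows "reduce (sect 1 (wsub \<sigma> w)) = []"
proof -
  have "snd ` set (sect 1 (wsub \<sigma> w)) \<subseteq> {0}" "wev (\<lambda>_. 1) (sect 1 (wsub \<sigma> w)) = - ey w"
    by (induction w) (simp_all add: sect_wsub_Cons del: wsub.simps(2))
  then show ?thesis using assms by (simp add: reduce_single_generator)
qed

lemma sect_2_wsub: assumes "ex w = 0" shows "reduce (sect 2 (wsub \<sigma> w)) = []"
proof -
  have "snd ` set (sect 2 (wsub \<sigma> w)) \<subseteq> {1}" "wev (\<lambda>_. 1) (sect 2 (wsub \<sigma> w)) = - ex w"
    by (induction w) (auto simp: sect_wsub_Cons simp del: wsub.simps(2))
  then show ?thesis using assms by (simp add: reduce_single_generator)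
qed

definition xconj :: "nat letter list \<Rightarrow> nat letter list" where
  "xconj w = gen 0 @ w @ winv (gen 0)"

text \<open>A word whose sections at 0, 2, 1 are \<open>u\<close>, \<open>v\<close>, \<open>w\<close> if their exponent sums vanish.\<close>

definition assemble :: "nat letter list \<Rightarrow> nat letter list \<Rightarrow> nat letter list \<Rightarrow> nat letter list" where
  "assemble u v w = wsub \<sigma> u @ xconj (wsub \<sigma> v) @ xconj (xconj (wsub \<sigma> w))"

lemma dg_xconj [simp]: "dg (xconj w) = dg w"
  by (simp add: xconj_def)

lemma dg_assemble [simp]: "dg (assemble u v w) = 0"
  by (simp add: assemble_def)

lemma letters_assemble: "snd ` set (assemble u v w) \<subseteq> {0, 1}"
  using letters_\<sigma> unfolding assemble_def xconj_def gen_def by (auto simp: image_Un)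

lemma sect_xconj:
  assumes "dg w = 0"
  shows "sect 0 (xconj w) = xconj (sect 1 w)" "sect 1 (xconj w) = sect 2 w"
    "sect 2 (xconj w) = sect 0 w"
  using assms by (simp_all add: xconj_def gen_def sect_append active_def winv_def inv_letter_def numeral_3_eq_0)

lemma reduce_xconj_Nil: "reduce w = [] \<Longrightarrow> reduce (xconj w) = []"
  using reduce_append_cong[of "gen 0" "gen 0" "w @ winv (gen 0)" "winv (gen 0)"] by (simp add: xconj_def)

lemma sect_assemble:
  assumes "ex u = 0" "ey u = 0" "ex v = 0" "ey v = 0" "ex w = 0" "ey w = 0"
  shows "reduce (sect 0 (assemble u v w)) = reduce (sect 0 (wsub \<sigma> u))"
    "reduce (sect 2 (assemble u v w)) = reduce (sect 0 (wsub \<sigma> v))"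
    "reduce (sect 1 (assemble u v w)) = reduce (sect 0 (wsub \<sigma> w))"
  using assms
  by (simp_all add: assemble_def sect_append sect_xconj reduce_xconj_Nil sect_1_wsub sect_2_wsub)

text \<open>The normal form puts the value of \<open>w\<close> into \<open>A\<close>, so modulo
  \<open>N\<close> it is an assembled word. As \<open>N\<close> itself has trivial sections, so has
  the assembled word; but these sections are its three constituents, which are therefore trivial in
  F.\<close>

lemma trivial_sections_in_normal_closure:
  assumes w: "snd ` set w \<subseteq> {0, 1}" "dg w = 0" and sect: "\<And>i. reduce (sect i w) = []"
  shows "reduce w \<in> normal_closure (free_group {0, 1}) (reduce ` base_words)"
proof -
  note One_nat_def [simp del]
  let ?F = "free_group {0, 1 :: nat}"
  interpret F: group ?F by (rule group_free_group)
  define N where "N = normal_closure ?F (reduce ` base_words)"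
  have N: "N \<lhd> ?F" unfolding N_def
    by (intro normal_closure_normal group_free_group base_words_carrier)
  obtain c :: "nat \<Rightarrow> nat letter list set bijection"
    where c: "\<And>w. snd ` set w \<subseteq> {0, 1} \<Longrightarrow> wev c w = 0 \<longleftrightarrow> reduce w \<in> N"
    using free_group_quotient_action[OF N] by metis
  have rel: "wev c r = 0" if "r \<in> base_words" for r
  proof -
    have "reduce r \<in> N"
      using that normal_closure_subset[of "reduce ` base_words" ?F] unfolding N_def by blast
    then show ?thesis using c[of r] letters_base_words[OF that] by simp
  qed
  interpret relations "c 0" "c 1" "wev c word_p0" "wev c word_pm" "wev c word_p1" "wev c word_z"
    "wev c word_v"
  proof
    have *: "commutes (wev c u) (wev c v)" if "wcomm u v \<in> base_words" for u v
      using rel[OF that] by (simp add: wev_wcomm comm_eq_0_iff)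
    show "wev c word_p0 = c 0 - c 1" "wev c word_pm = - c 1 + c 0"
      "wev c word_p1 = gconj (c 0) (wev c word_p0)"
      by (simp_all only: word_defs gen_def wev_append wev_winv wev.simps gconj_def group_norm) simp_all
    show "wev c word_z = c 0 + c 0 + c 0 - wev c word_p0"
      by (simp only: word_z_def gen_def wev_append wev_winv wev.simps group_norm) simp
    show "wev c word_v = - wev c word_p1 + wev c word_z" by (simp add: word_v_def)
    have "commutes (wev c word_v) (wev c word_p0)" "commutes (wev c word_z) (wev c word_pm)"
      "commutes (wev c word_k) (wev c word_p0)" "commutes (wev c word_d) (wev c word_pm)"
      "commutes (wev c word_k) (wev c word_d)" "commutes (wev c (word_v @ word_p0)) (wev c word_d)"
      "commutes (wev c (word_z @ winv word_pm)) (wev c word_k)"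
      by (rule *; simp only: base_words_def insert_iff simp_thms)+
    then show "commutes (wev c word_v) (wev c word_p0)" "commutes (wev c word_z) (wev c word_pm)"
      "commutes (comm (wev c word_pm) (wev c word_v)) (wev c word_p0)"
      "commutes (comm (wev c word_z) (wev c word_p0)) (wev c word_pm)"
      "commutes (comm (wev c word_pm) (wev c word_v)) (comm (wev c word_z) (wev c word_p0))"
      "commutes (wev c word_v + wev c word_p0) (comm (wev c word_z) (wev c word_p0))"
      "commutes (wev c word_z - wev c word_pm) (comm (wev c word_pm) (wev c word_v))"
      by (simp_all add: word_k_def word_d_def wev_wcomm)
  qed
  have wev_c: "wev c u = wev (\<lambda>k. if k = 0 then c 0 else c 1) u" if "snd ` set u \<subseteq> {0, 1}" for u
    using that by (induction u) auto
  have f: "wev c (wsub \<sigma> u) = f u" for u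
    unfolding wev_wsub f_def
    by (rule arg_cong[where f = "\<lambda>h. wev h u"]) (auto simp: \<sigma>_def p0 pm minus_add)
  \<comment> \<open>\<open>u\<close> may contain letters above 1; its section-0 copy has them
    renamed to 1, and the value of \<open>f\<close> is unchanged.\<close>
  have f0: "f u = 0" if "reduce (sect 0 (wsub \<sigma> u)) = []" for u
  proof -
    have "f u = f (reduce (sect 0 (wsub \<sigma> u)))"
      unfolding f_def wev_reduce by (rule sect_0_wsub'[symmetric])
    then show ?thesis by (simp add: that f_def)
  qed
  \<comment> \<open>The preimage of \<open>A\<close> in F; passing to F/\<open>NA\<close> turns
    membership in \<open>A\<close> into equations.\<close>
  define NA where "NA = {u \<in> carrier ?F. wev c u \<in> A}"
  have "NA \<lhd> ?F"
  proof -
    have "subgroup NA ?F"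
    proof (rule F.subgroupI)
      have "[] \<in> NA" using A3_in_A[OF A3_0] by (simp add: NA_def carrier_free_group)
      then show "NA \<noteq> {}" by blast
      show "inv\<^bsub>?F\<^esub> u \<in> NA" if "u \<in> NA" for u
      proof -
        have "inv\<^bsub>?F\<^esub> u \<in> carrier ?F" "inv\<^bsub>?F\<^esub> u = reduce (winv u)"
          using that inv_free_group[of u "{0, 1}"] F.inv_closed[of u] by (simp_all add: NA_def)
        then show ?thesis using that A_minus by (simp add: NA_def)
      qed
      show "u \<otimes>\<^bsub>?F\<^esub> v \<in> NA" if "u \<in> NA" "v \<in> NA" for u v
      proof -
        have "u \<otimes>\<^bsub>?F\<^esub> v \<in> carrier ?F" using that by (auto simp: NA_def)
        then show ?thesis using that A_add by (simp add: mult_free_group NA_def)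
      qed
    qed (auto simp: NA_def)
    then show ?thesis
    proof (rule F.normal_invI)
      fix g u assume g: "g \<in> carrier ?F" and u: "u \<in> NA"
      have "g \<otimes>\<^bsub>?F\<^esub> u \<otimes>\<^bsub>?F\<^esub> inv\<^bsub>?F\<^esub> g \<in> carrier ?F" using g u by (auto simp: NA_def)
      moreover have "wev c (g \<otimes>\<^bsub>?F\<^esub> u \<otimes>\<^bsub>?F\<^esub> inv\<^bsub>?F\<^esub> g) = gconj (wev c g) (wev c u)"
        using g by (simp add: mult_free_group inv_free_group gconj_def)
      moreover have "gconj (wev c g) (wev c u) \<in> A"
        using u g normalizes_wev[of g] wev_c[of g]
        by (simp add: NA_def normalizes_def carrier_free_group)
      ultimately show "g \<otimes>\<^bsub>?F\<^esub> u \<otimes>\<^bsub>?F\<^esub> inv\<^bsub>?F\<^esub> g \<in> NA" by (simp add: NA_def)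
    qed
  qed
  then obtain c' :: "nat \<Rightarrow> nat letter list set bijection"
    where "\<And>w. snd ` set w \<subseteq> {0, 1} \<Longrightarrow> wev c' w = 0 \<longleftrightarrow> reduce w \<in> NA"
    using free_group_quotient_action by metis
  then have c': "wev c' u = 0 \<longleftrightarrow> wev c u \<in> A" if "snd ` set u \<subseteq> {0, 1}" for u
    using that reduce_in_carrier[OF that] by (simp add: NA_def)
  have c'_comm: "commutes (wev c' u) (wev c' v)"
    if "comm (wev c u) (wev c v) \<in> A" "snd ` set u \<subseteq> {0, 1}" "snd ` set v \<subseteq> {0, 1}" for u v
    using that c'[of "wcomm u v"] by (simp add: wev_wcomm comm_eq_0_iff)
  define t where "t = gen 0 @ gen 0 @ gen 0"
  have t: "snd ` set t \<subseteq> {0, 1}" "wev c t = c 0 + c 0 + c 0" "wev c' t = c' 0 + c' 0 + c' 0"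
    by (simp_all add: t_def gen_def add.assoc)
  have "commutes (wev c' t) (wev c' word_pm)" "commutes (wev c' t) (wev c' word_p1)"
    by (rule c'_comm; simp add: t comm_t_pm comm_t_p1)+
  moreover have "commutes (wev c' word_p1) (wev c' word_p0)"
    by (rule c'_comm) (simp_all add: comm_p1_p0)
  moreover have "commutes (wev c' word_pm) (wev c' word_p0)"
    by (rule commutes_sym, rule c'_comm) (simp_all add: A3_in_A comm_p0_pm)
  \<comment> \<open>Modulo \<open>A\<close>, x^3 centralizes p_-1, so p_-1 may be replaced by its
    x^3-conjugate p_2, whose commutator with p_1 is under control.\<close>
  moreover have "commutes (wev c' (t @ word_pm @ winv t)) (wev c' word_p1)"
  proof (rule c'_comm)
    have "wev c (t @ word_pm @ winv t) = gconj (c 0 + c 0 + c 0) (wev c word_pm)"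
      by (simp only: wev_append wev_winv t gconj_def group_norm)
    then show "comm (wev c (t @ word_pm @ winv t)) (wev c word_p1) \<in> A"
      using comm_p1_tpm by simp
    show "snd ` set (t @ word_pm @ winv t) \<subseteq> {0, 1}" "snd ` set word_p1 \<subseteq> {0, 1}"
      using t(1) unfolding set_append image_Un letters_winv letters_words by simp_all
  qed
  moreover have "wev c' (t @ word_pm @ winv t) = gconj (wev c' t) (wev c' word_pm)"
    by (simp only: wev_append wev_winv gconj_def group_norm)
  ultimately have comms: "commutes (wev c' word_pm) (wev c' word_p1)"
      "commutes (wev c' word_pm) (wev c' word_p0)" "commutes (wev c' word_p0) (wev c' word_p1)"
      "commutes (c' 0 + c' 0 + c' 0) (wev c' word_p1)"
    using t by (simp_all add: commutes_iff_conj[of "c' 0 + c' 0 + c' 0" "wev c' word_pm"] commutes_sym)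
  have "wev c' w = zpow (c' 0) (ex w + ey w) + zpow (wev c' word_pm) (- ey (sect 0 w))
      + zpow (wev c' word_p0) (- ey (sect 2 w)) + zpow (wev c' word_p1) (- ey (sect 1 w))"
  proof (rule abelian_normal_form)
    show "wev c' word_p0 = c' 0 - c' 1" "wev c' word_pm = - c' 1 + c' 0"
      "wev c' word_p1 = gconj (c' 0) (wev c' word_p0)"
      by (simp_all only: word_defs gen_def wev_append wev_winv wev.simps gconj_def group_norm) simp_all
  qed (use comms w in simp_all)
  moreover have exey: "ex (sect i w) = 0" "ey (sect i w) = 0" for i
    using ex_simps(4)[of "sect i w"] ey_simps(4)[of "sect i w"] sect[of i] by simp_all
  moreover have "ex w = 0" "ey w = 0"
    using ex_sect[of w] ey_sect[of w] exey by simp_all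
  ultimately have "wev c' w = 0" by simp
  then have "wev c w \<in> A" using c'[OF w(1)] by simp
  then obtain u v u' where u: "wev c w = f u + gconj (c 0) (f v) + gconj (c 0 + c 0) (f u')"
    and uv: "ex u = 0" "ey u = 0" "ex v = 0" "ey v = 0" "ex u' = 0" "ey u' = 0"
    by (auto simp: A_def A3_def)
  define \<alpha> where "\<alpha> = assemble u v u'"
  have "wev c \<alpha> = wev c w"
    unfolding u f[symmetric] \<alpha>_def assemble_def xconj_def gen_def
    by (simp only: wev_append wev_winv wev.simps gconj_def group_norm) simp
  then have "wev c (w @ winv \<alpha>) = 0" by simp
  moreover have letters: "snd ` set (w @ winv \<alpha>) \<subseteq> {0, 1}"
    using w letters_assemble[of u v u'] unfolding \<alpha>_def set_append image_Un letters_winv by simp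
  ultimately have "reduce (w @ winv \<alpha>) \<in> N" using c by blast
  moreover have "N \<subseteq> {w \<in> carrier ?F. dg w = 0 \<and> (\<forall>i. reduce (sect i w) = [])}"
    unfolding N_def
  proof (rule normal_closure_minimal[OF trivial_sections_normal], rule image_subsetI)
    fix r assume "r \<in> base_words"
    then show "reduce r \<in> {w \<in> carrier ?F. dg w = 0 \<and> (\<forall>i. reduce (sect i w) = [])}"
      using base_words_carrier dg_base_words sect_base_words by auto
  qed
  ultimately have "reduce (sect i (w @ winv \<alpha>)) = []" for i
    using reduce_sect_reduce[of i "w @ winv \<alpha>"] by auto
  then have "reduce (sect i \<alpha>) = []" for i
    using sect by (simp add: sect_append sect_winv \<alpha>_def)
  then have "reduce (sect 0 (wsub \<sigma> u)) = []" "reduce (sect 0 (wsub \<sigma> v)) = []"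
    "reduce (sect 0 (wsub \<sigma> u')) = []"
    using sect_assemble[OF uv] by (simp_all add: \<alpha>_def)
  then have "f u = 0" "f v = 0" "f u' = 0"
    by (simp_all add: f0)
  then have "wev c w = 0" by (simp add: u)
  then show ?thesis using c[OF w(1)] by (simp add: N_def)
qed

section \<open>Words acting on the tree\<close>

lemma inv_tree_aut:
  assumes "g \<in> carrier (tree_aut :: ('a::finite list \<Rightarrow> 'a list) monoid)"
  shows "inv\<^bsub>tree_aut\<^esub> g = inv_into UNIV g"
proof -
  interpret group "tree_aut :: ('a list \<Rightarrow> 'a list) monoid" by (rule group_tree_aut)
  have "inv\<^bsub>tree_aut\<^esub> g \<circ> g = id" using l_inv[OF assms] by (simp add: tree_aut_def)
  moreover have "bij g" using assms by (simp add: tree_aut_def)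
  ultimately show ?thesis by (metis bij_is_surj inv_unique_comp comp_assoc comp_id id_comp surj_iff)
qed

fun rot :: "3 \<Rightarrow> 3 list \<Rightarrow> 3 list" where
  "rot i [] = []"
| "rot i (j # \<tau>) = (j + i) # \<tau>"

lemma rot_rot [simp]: "rot i (rot j \<tau>) = rot (i + j) \<tau>"
  by (cases \<tau>) (simp_all add: algebra_simps)

lemma rot_0 [simp]: "rot 0 \<tau> = \<tau>"
  by (cases \<tau>) simp_all

lemma tree_a_eq: "tree_a = rot 1"
proof
  show "tree_a \<tau> = rot 1 \<tau>" for \<tau> by (cases \<tau>) simp_all
qed

lemma inv_tree_a: "inv\<^bsub>tree_aut\<^esub> tree_a = rot 2"
  unfolding inv_tree_aut[OF tree_a_in_tree_aut]
  by (rule inv_unique_comp) (simp_all add: fun_eq_iff tree_a_eq numeral_3_eq_0)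

lemma tree_x_eq: "tree_x \<tau> = tree_s (rot 2 \<tau>)" and tree_y_eq: "tree_y \<tau> = rot 2 (tree_s \<tau>)"
  by (simp_all add: tree_x_def tree_y_def inv_tree_a) (simp_all add: tree_aut_def)

definition generator :: "nat \<Rightarrow> 3 list \<Rightarrow> 3 list" where
  "generator k = (if k = 0 then tree_x else if k = 1 then tree_y else tree_a)"

definition tgen :: "nat \<Rightarrow> 3 list bijection" where
  "tgen k = Bijection (generator k)"

abbreviation tev :: "nat letter list \<Rightarrow> 3 list \<Rightarrow> 3 list" where
  "tev w \<equiv> app (wev tgen w)"

lemma generator_in_tree_aut: "generator k \<in> carrier tree_aut"
proof -
  interpret group "tree_aut :: (3 list \<Rightarrow> 3 list) monoid" by (rule group_tree_aut)
  show ?thesis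
    by (simp add: generator_def tree_x_def tree_y_def tree_a_in_tree_aut tree_s_in_tree_aut)
qed

lemma app_tgen: "app (tgen k) = generator k"
  using generator_in_tree_aut[of k] by (simp add: tgen_def Bijection_inverse tree_aut_def)

lemma app_minus_tgen: "app (- tgen k) = inv\<^bsub>tree_aut\<^esub> generator k"
  by (simp add: app_minus app_tgen inv_tree_aut generator_in_tree_aut)

lemma app_minus_eqI: "app g \<tau> = \<rho> \<Longrightarrow> app (- g) \<rho> = \<tau>"
  by (metis app_minus bij_app bij_is_inj inv_f_f)

lemma app_eq_id_iff: "app g = id \<longleftrightarrow> g = 0"
  by (metis app_inject app_zero)

lemma generator_Nil: "generator k [] = []"
  by (simp add: generator_def tree_x_eq tree_y_eq)

lemma tev_Nil [simp]: "tev w [] = []"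
proof (induction w)
  case (Cons l w)
  moreover have "app (- tgen k) [] = []" for k
    by (rule app_minus_eqI) (simp add: app_tgen generator_Nil)
  ultimately show ?case by (simp add: app_tgen generator_Nil)
qed simp

lemma minus_one_3: "(2 :: 3) = - 1"
  by simp

text \<open>As s = xa = ay, the two twists turn x or y into s at the active vertex; elsewhere they
  compose to \<open>rot 1\<close>, which is a.\<close>

lemma generator_Cons:
  assumes "k \<in> {0, 1}"
  shows "generator k (j # \<tau>) = (j - 1) # rot (1 - j) ((if active (False, k) j then generator k else id) (rot j \<tau>))"
  using assms exhaust_3[of j]
  by (auto simp: generator_def tree_x_eq tree_y_eq active_def tree_a_eq numeral_3_eq_0 minus_one_3)

lemma tev_letter:
  assumes "snd l \<in> {0, 1}"
  shows "tev [l] (j # \<tau>) = (j - dg [l]) # rot (dg [l] - j) (tev (if active l j then [l] else []) (rot j \<tau>))"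
proof (cases l)
  case (Pair b k)
  then have k: "k \<in> {0, 1}" using assms by simp
  show ?thesis
  proof (cases b)
    case True
    have "app (- tgen k) (j # \<tau>) = (j + 1) # rot (- 1 - j) ((if active (False, k) (j + 1) then app (- tgen k) else id) (rot j \<tau>))"
    proof (rule app_minus_eqI)
      have "app (tgen k) (app (- tgen k) \<rho>) = \<rho>" for \<rho>
        by (metis app_plus app_zero comp_apply id_apply right_minus)
      then show "app (tgen k) ((j + 1) # rot (- 1 - j) ((if active (False, k) (j + 1) then app (- tgen k) else id) (rot j \<tau>))) = j # \<tau>"
        by (simp add: app_tgen generator_Cons[OF k])
    qed
    then show ?thesis using Pair True by (simp add: active_def)
  next
    case False
    then show ?thesis using Pair generator_Cons[OF k] by (simp add: app_tgen)
  qed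
qed

text \<open>The twists telescope: the outgoing rotation of one letter cancels the incoming rotation
  of the next.\<close>

lemma tev_Cons:
  assumes "snd ` set w \<subseteq> {0, 1}"
  shows "tev w (i # \<tau>) = (i - dg w) # rot (dg w - i) (tev (sect i w) (rot i \<tau>))"
  using assms
proof (induction w)
  case (Cons l w)
  have "tev (l # w) (i # \<tau>) = tev [l] (tev w (i # \<tau>))" by simp
  also have "\<dots> = tev [l] ((i - dg w) # rot (dg w - i) (tev (sect i w) (rot i \<tau>)))"
    using Cons by simp
  also have "\<dots> = (i - dg (l # w)) # rot (dg (l # w) - i) (tev (sect i (l # w)) (rot i \<tau>))"
    using Cons.prems by (subst tev_letter) (auto simp: algebra_simps)
  finally show ?case .
qed simp

lemma wev_tgen_eq_0_iff:
  assumes "snd ` set w \<subseteq> {0, 1}"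
  shows "wev tgen w = 0 \<longleftrightarrow> dg w = 0 \<and> (\<forall>i. wev tgen (sect i w) = 0)"
proof (intro iffI conjI allI)
  assume "wev tgen w = 0"
  then have w: "tev w = id" by simp
  show "dg w = 0" using tev_Cons[OF assms, of 0 "[]"] w by simp
  fix i
  have "tev (sect i w) \<tau> = \<tau>" for \<tau>
  proof -
    have "rot (- i) (tev (sect i w) \<tau>) = rot (- i) \<tau>"
      using tev_Cons[OF assms, of i "rot (- i) \<tau>"] w \<open>dg w = 0\<close> by simp
    then have "rot i (rot (- i) (tev (sect i w) \<tau>)) = rot i (rot (- i) \<tau>)" by simp
    then show ?thesis by simp
  qed
  then show "wev tgen (sect i w) = 0" by (simp add: fun_eq_iff flip: app_eq_id_iff)
next
  assume *: "dg w = 0 \<and> (\<forall>i. wev tgen (sect i w) = 0)"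
  have "tev w \<tau> = \<tau>" for \<tau>
    using * by (cases \<tau>) (simp_all add: tev_Cons[OF assms])
  then show "wev tgen w = 0" by (simp add: fun_eq_iff flip: app_eq_id_iff)
qed

text \<open>Short words need not contract (yx is its own section at 1), but the degrees of the word
  and of its sections must vanish, which leaves only the empty word.\<close>

lemma short_trivial_word:
  assumes "snd ` set w \<subseteq> {0, 1}" "reduced w" "length w < 3" "wev tgen w = 0"
  shows "w = []"
proof -
  have dg: "dg w = 0" "dg (sect i w) = 0" for i
    using assms wev_tgen_eq_0_iff letters_sect[of i w] by (meson order_trans)+
  consider "w = []" | l where "w = [l]" | l m where "w = [l, m]"
    using assms(3) by (cases w; cases "tl w") auto
  then show ?thesis
  proof cases
    case (3 l m)
    then show ?thesis
      using assms(1,2) dg(1) dg(2)[of 0] dg(2)[of 1] dg(2)[of 2]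
      by (cases l; cases m) (auto simp: active_def reduced_Cons inv_letter_def split: if_splits)
  qed (use dg(1) in \<open>auto split: if_splits\<close>)
qed

text \<open>Induction on the length: sections of a reduced word with at least three letters are
  shorter, and a shorter reduced word that acts trivially is empty.\<close>

lemma trivial_word_induct [consumes 2, case_names Nil step]:
  assumes "snd ` set w \<subseteq> {0, 1}" "wev tgen w = 0"
    and Nil: "P []"
    and step: "\<And>w. reduced w \<Longrightarrow> snd ` set w \<subseteq> {0, 1} \<Longrightarrow> wev tgen w = 0 \<Longrightarrow> dg w = 0 \<Longrightarrow>
      (\<And>i. snd ` set (reduce (sect i w)) \<subseteq> {0, 1} \<and> P (reduce (sect i w))) \<Longrightarrow> P w"
  shows "P (reduce w)"
proof -
  have reduced_case: "snd ` set w \<subseteq> {0, 1} \<Longrightarrow> wev tgen w = 0 \<Longrightarrow> reduced w \<Longrightarrow> P w" for w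
  proof (induction w rule: measure_induct_rule[of length])
    case (less w)
    note letters = less.prems(1) and trivial = less.prems(2) and red = less.prems(3)
    show ?case
    proof (cases "length w < 3")
      case True
      then have "w = []" using short_trivial_word letters trivial red by simp
      then show ?thesis using Nil by simp
    next
      case False
      have dg: "dg w = 0" and sect: "wev tgen (sect i w) = 0" for i
        using trivial wev_tgen_eq_0_iff[OF letters] by simp_all
      have letters': "snd ` set (reduce (sect i w)) \<subseteq> {0, 1}" for i
        by (rule order_trans[OF letters_reduce order_trans[OF letters_sect letters]])
      have P: "P (reduce (sect i w))" for i
      proof (rule less.IH[OF _ letters'])
        show "length (reduce (sect i w)) < length w"
          using length_reduce[of "sect i w"] length_sect_less[OF red letters, of i] False by simp
        show "wev tgen (reduce (sect i w)) = 0" using sect by simp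
        show "reduced (reduce (sect i w))" by (rule reduced_reduce)
      qed
      show ?thesis by (rule step[OF red letters trivial dg]) (intro conjI letters' P)
    qed
  qed
  show ?thesis
  proof (rule reduced_case)
    show "snd ` set (reduce w) \<subseteq> {0, 1}" by (rule order_trans[OF letters_reduce assms(1)])
    show "wev tgen (reduce w) = 0" using assms(2) by simp
    show "reduced (reduce w)" by (rule reduced_reduce)
  qed
qed

lemma trivial_word_exponents:
  assumes "snd ` set w \<subseteq> {0, 1}" "wev tgen w = 0"
  shows "ex w = 0" "ey w = 0"
proof -
  have "ex (reduce w) = 0 \<and> ey (reduce w) = 0"
    using assms
  proof (induction rule: trivial_word_induct)
    case (step w)
    then have "ex (sect i w) = 0" "ey (sect i w) = 0" for i by simp_all
    then show ?case using ex_sect[of w] ey_sect[of w] by simp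
  qed simp
  then show "ex w = 0" "ey w = 0" by simp_all
qed

text \<open>The cube of such a word acts trivially, so its integer exponent sums vanish; hence so do
  those of the word itself, and its degree.\<close>

lemma rot_not_in_K:
  assumes "snd ` set w \<subseteq> {0, 1}" "tev w = rot j"
  shows "j = 0"
proof -
  have "tev (w @ w @ w) = rot (j + j + j)" using assms(2) by (auto simp: fun_eq_iff algebra_simps)
  moreover have "j + j + j = 0" using exhaust_3[of j] by auto
  ultimately have "tev (w @ w @ w) = id" by (simp add: fun_eq_iff)
  then have "wev tgen (w @ w @ w) = 0" by (simp only: app_eq_id_iff)
  then have "ex (w @ w @ w) = 0" "ey (w @ w @ w) = 0"
    by (intro trivial_word_exponents; use assms(1) in \<open>simp add: image_Un\<close>)+
  then have "dg w = 0" by (simp add: dg_eq)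
  then show ?thesis using tev_Cons[OF assms(1), of 0 "[]"] assms(2) by simp
qed

section \<open>The L-presentation of \<open>K\<close>\<close>

definition \<Phi> :: "nat letter list \<Rightarrow> nat letter list" where
  "\<Phi> w = reduce (wsub \<sigma> w)"

definition relators :: "nat letter list set" where
  "relators = (\<Union>\<phi> \<in> endo_monoid {\<Phi>}. \<phi> ` reduce ` base_words)"

lemma \<Phi>_hom: "{0, 1} \<subseteq> S \<Longrightarrow> \<Phi> \<in> hom (free_group S) (free_group S)"
  unfolding \<Phi>_def by (rule wsub_hom) (auto simp: \<sigma>_def)

lemma relators_base: "r \<in> base_words \<Longrightarrow> reduce r \<in> relators"
  unfolding relators_def by (rule UN_I[OF endo_monoid.one]) simp

lemma relators_\<Phi>:
  assumes "r \<in> relators"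
  shows "\<Phi> r \<in> relators"
proof -
  obtain \<phi> r' where r: "\<phi> \<in> endo_monoid {\<Phi>}" "r' \<in> base_words" "r = \<phi> (reduce r')"
    using assms by (auto simp: relators_def)
  have "(\<Phi> \<circ> \<phi>) (reduce r') \<in> relators"
    unfolding relators_def
    by (rule UN_I[OF endo_monoid.comp[OF singletonI r(1)]]) (rule imageI[OF imageI[OF r(2)]])
  then show ?thesis by (simp add: r(3))
qed

lemma relators_induct [consumes 1, case_names base step]:
  assumes "r \<in> relators"
    and base: "\<And>r. r \<in> base_words \<Longrightarrow> P (reduce r)" and step: "\<And>r. P r \<Longrightarrow> P (\<Phi> r)"
  shows "P r"
proof -
  obtain \<phi> r' where r: "r = \<phi> (reduce r')" "r' \<in> base_words" "\<phi> \<in> endo_monoid {\<Phi>}"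
    using assms(1) by (auto simp: relators_def)
  have "P (\<phi> (reduce r'))"
    using r(3) by induction (use base r(2) step in auto)
  then show ?thesis by (simp add: r(1))
qed

lemma wev_kernel_normal: "{w \<in> carrier (free_group S). wev c w = 0} \<lhd> free_group S" (is "?M \<lhd> ?F")
proof -
  interpret F: group ?F by (rule group_free_group)
  have "subgroup ?M ?F"
  proof (rule F.subgroupI)
    have "[] \<in> ?M" by (simp add: carrier_free_group)
    then show "?M \<noteq> {}" by blast
    show "inv\<^bsub>?F\<^esub> u \<in> ?M" if "u \<in> ?M" for u
      using that F.inv_closed[of u] by (simp add: inv_free_group)
    show "u \<otimes>\<^bsub>?F\<^esub> v \<in> ?M" if "u \<in> ?M" "v \<in> ?M" for u v
      using that F.m_closed[of u v] by (simp add: mult_free_group)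
  qed auto
  then show ?thesis
  proof (rule F.normal_invI)
    fix g u assume g: "g \<in> carrier ?F" and u: "u \<in> ?M"
    then have "g \<otimes>\<^bsub>?F\<^esub> u \<otimes>\<^bsub>?F\<^esub> inv\<^bsub>?F\<^esub> g \<in> carrier ?F" by auto
    moreover have "wev c (g \<otimes>\<^bsub>?F\<^esub> u \<otimes>\<^bsub>?F\<^esub> inv\<^bsub>?F\<^esub> g) = 0"
      using g u by (simp add: mult_free_group inv_free_group)
    ultimately show "g \<otimes>\<^bsub>?F\<^esub> u \<otimes>\<^bsub>?F\<^esub> inv\<^bsub>?F\<^esub> g \<in> ?M" by simp
  qed
qed

lemma relators_letters_trivial: "r \<in> relators \<Longrightarrow> r \<in> carrier (free_group {0, 1}) \<and> wev tgen r = 0"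
proof (induction rule: relators_induct)
  case (base r)
  have r: "snd ` set r \<subseteq> {0, 1}" using letters_base_words[OF base] by simp
  moreover have "wev tgen (sect i r) = 0" for i
    using sect_base_words[OF base, of i] wev_reduce[of tgen "sect i r"] by simp
  ultimately have "wev tgen r = 0"
    using wev_tgen_eq_0_iff[OF r] dg_base_words[OF base] by simp
  then show ?case using reduce_in_carrier[OF r] by simp
next
  case (step r)
  then have r: "snd ` set r \<subseteq> {0, 1}" and "wev tgen r = 0" by (auto simp: carrier_free_group)
  \<comment> \<open>Vanishing exponent sums are what confines the substituted word to section 0,
    where it equals \<open>r\<close>.\<close>
  have exey: "ex r = 0" "ey r = 0" using trivial_word_exponents r \<open>wev tgen r = 0\<close> by auto
  have "wev tgen (sect 0 (wsub \<sigma> r)) = 0" by (simp add: sect_0_wsub[OF r] \<open>wev tgen r = 0\<close>)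
  moreover have "wev tgen (sect 1 (wsub \<sigma> r)) = 0"
    using sect_1_wsub[OF exey(2)] by (metis wev.simps(1) wev_reduce)
  moreover have "wev tgen (sect 2 (wsub \<sigma> r)) = 0"
    using sect_2_wsub[OF exey(1)] by (metis wev.simps(1) wev_reduce)
  ultimately have "wev tgen (wsub \<sigma> r) = 0"
    using wev_tgen_eq_0_iff[OF letters_\<sigma>, of r] by (simp add: all_3)
  then show ?case using reduce_in_carrier[OF letters_\<sigma>, of r] by (simp add: \<Phi>_def)
qed

lemma trivial_word_in_normal_closure:
  assumes w: "snd ` set w \<subseteq> {0, 1}" "wev tgen w = 0"
  shows "reduce w \<in> normal_closure (free_group {0, 1}) relators"
proof -
  let ?F = "free_group {0, 1 :: nat}"
  define L where "L = normal_closure ?F relators"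
  have "relators \<subseteq> carrier ?F" using relators_letters_trivial by blast
  then have L: "L \<lhd> ?F" unfolding L_def by (intro normal_closure_normal group_free_group)
  obtain c :: "nat \<Rightarrow> nat letter list set bijection"
    where c: "\<And>w. snd ` set w \<subseteq> {0, 1} \<Longrightarrow> wev c w = 0 \<longleftrightarrow> reduce w \<in> L"
    using free_group_quotient_action[OF L] by metis
  have relators_L: "relators \<subseteq> L" unfolding L_def by (rule normal_closure_subset)
  have sections: "wev c u = 0"
    if "snd ` set u \<subseteq> {0, 1}" "dg u = 0" "\<And>i. reduce (sect i u) = []" for u
  proof -
    have "normal_closure ?F (reduce ` base_words) \<subseteq> L"
      using relators_L relators_base by (intro normal_closure_minimal L) blast
    then show ?thesis
      using trivial_sections_in_normal_closure[OF that] c[OF that(1)] by blast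
  qed
  \<comment> \<open>The relators are closed under \<open>\<Phi>\<close>, so the substitution induces
    an endomorphism of the quotient by \<open>L\<close>.\<close>
  have \<sigma>: "wev c (wsub \<sigma> u) = 0" if "snd ` set u \<subseteq> {0, 1}" "wev c u = 0" for u
  proof -
    have "relators \<subseteq> {u \<in> carrier ?F. wev (\<lambda>k. wev c (\<sigma> k)) u = 0}"
    proof safe
      fix r assume r: "r \<in> relators"
      then have "reduce (wsub \<sigma> r) \<in> L" using relators_\<Phi> relators_L unfolding \<Phi>_def by blast
      then show "wev (\<lambda>k. wev c (\<sigma> k)) r = 0" using c[OF letters_\<sigma>, of r] by (simp add: wev_wsub)
      show "r \<in> carrier ?F" using r relators_letters_trivial by blast
    qed
    then have "L \<subseteq> {u \<in> carrier ?F. wev (\<lambda>k. wev c (\<sigma> k)) u = 0}"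
      unfolding L_def by (rule normal_closure_minimal[OF wev_kernel_normal])
    then have "wev (\<lambda>k. wev c (\<sigma> k)) (reduce u) = 0" using c that by blast
    then show ?thesis by (simp add: wev_wsub)
  qed
  have "wev c (reduce w) = 0"
    using w
  proof (induction rule: trivial_word_induct)
    case (step w)
    define u where "u i = reduce (sect i w)" for i
    have u: "snd ` set (u i) \<subseteq> {0, 1}" "wev c (u i) = 0" "ex (u i) = 0" "ey (u i) = 0" for i
    proof -
      have i: "snd ` set (sect i w) \<subseteq> {0, 1}" using letters_sect step(2) by (rule order_trans)
      moreover have "wev tgen (sect i w) = 0" using wev_tgen_eq_0_iff[OF step(2)] step(3) by simp
      ultimately show "ex (u i) = 0" "ey (u i) = 0"
        using trivial_word_exponents by (simp_all add: u_def)
      show "snd ` set (u i) \<subseteq> {0, 1}" "wev c (u i) = 0" using step(5) by (auto simp: u_def)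
    qed
    define \<alpha> where "\<alpha> = assemble (u 0) (u 2) (u 1)"
    have "wev c (wsub \<sigma> (u i)) = 0" for i by (rule \<sigma>[OF u(1,2)])
    then have \<alpha>0: "wev c \<alpha> = 0"
      unfolding \<alpha>_def assemble_def xconj_def wev_append wev_winv by (simp only: group_norm)
    have "reduce (sect 0 \<alpha>) = reduce (u 0)" "reduce (sect 2 \<alpha>) = reduce (u 2)"
        "reduce (sect 1 \<alpha>) = reduce (u 1)"
      unfolding \<alpha>_def
      using sect_assemble[OF u(3,4) u(3,4) u(3,4), of 0 2 1] u(1) by (simp_all only: sect_0_wsub)
    then have sect: "reduce (sect i w) = reduce (sect i \<alpha>)" for i
      using exhaust_3[of i] by (auto simp: u_def)
    have dg: "dg (winv \<alpha>) = 0" "i + dg \<alpha> = i" for i by (simp_all add: \<alpha>_def)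
    \<comment> \<open>\<open>w\<close> and \<open>\<alpha>\<close> have equal sections, so they
      differ by an element killed by the seven base words alone.\<close>
    have "wev c (w @ winv \<alpha>) = 0"
    proof (rule sections)
      show "snd ` set (w @ winv \<alpha>) \<subseteq> {0, 1}"
        using step(2) letters_assemble[of "u 0" "u 2" "u 1"]
        unfolding \<alpha>_def set_append image_Un letters_winv by simp
      show "dg (w @ winv \<alpha>) = 0" using step(4) dg by simp
      have "reduce (sect i (w @ winv \<alpha>)) = reduce (sect i \<alpha> @ winv (sect i \<alpha>))" for i
        unfolding sect_append sect_winv dg by (rule reduce_append_cong) (simp_all add: sect)
      then show "reduce (sect i (w @ winv \<alpha>)) = []" for i by simp
    qed
    then show ?case using \<alpha>0 by simp
  qed simp
  then show ?thesis using c[OF w(1)] by (simp add: L_def)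
qed

section \<open>From kernels of word evaluation to presentations of K and
  \<open>Gamma_bar\<close>\<close>

lemma finitely_L_presentedI:
  fixes S :: "nat set"
  assumes G: "group G" and h: "h \<in> hom (free_group S) G" "h ` carrier (free_group S) = carrier G"
    and kernel: "{w \<in> carrier (free_group S). h w = \<one>\<^bsub>G\<^esub>}
      = normal_closure (free_group S) (Q \<union> (\<Union>\<phi> \<in> endo_monoid \<Psi>. \<phi> ` R))"
    and fin: "L_presentation S Q \<Psi> R" "finite S" "finite Q" "finite \<Psi>" "finite R"
  shows "finitely_L_presented G"
proof -
  interpret group_hom "free_group S" G h
    using G h(1) by (intro group_hom.intro group_free_group group_hom_axioms.intro)
  have "(free_group S Mod kernel (free_group S) G h) \<cong> G"
    by (rule FactGroup_iso[OF h(2)])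
  then have "L_group S Q \<Psi> R \<cong> G"
    unfolding L_group_def kernel[symmetric] kernel_def .
  moreover have "group (L_group S Q \<Psi> R)"
    unfolding L_group_def kernel[symmetric] using normal.factorgroup_is_group[OF normal_kernel]
    by (simp add: kernel_def)
  ultimately have "G \<cong> L_group S Q \<Psi> R" by (rule group.iso_sym[rotated])
  then show ?thesis
    unfolding finitely_L_presented_def
    by (intro exI[of _ S] exI[of _ Q] exI[of _ \<Psi>] exI[of _ R] conjI fin)
qed

lemma mult_tree_aut: "f \<otimes>\<^bsub>tree_aut\<^esub> g = f \<circ> g"
  and one_tree_aut: "\<one>\<^bsub>tree_aut\<^esub> = id"
  by (simp_all add: tree_aut_def)

lemma tev_in_generate:
  "snd ` set w \<subseteq> S \<Longrightarrow> tev w \<in> generate tree_aut (generator ` S)"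
proof (induction w)
  case Nil
  show ?case
    using generate.one[of tree_aut "generator ` S"] unfolding wev.simps app_zero one_tree_aut .
next
  case (Cons l w)
  have k: "generator (snd l) \<in> generator ` S" using Cons.prems by simp
  have "app (if fst l then - tgen (snd l) else tgen (snd l)) \<in> generate tree_aut (generator ` S)"
    using generate.incl[OF k, of tree_aut] generate.inv[OF k, of tree_aut] by (simp add: app_tgen app_minus_tgen)
  moreover have "tev w \<in> generate tree_aut (generator ` S)" using Cons by simp
  ultimately show ?case
    unfolding wev.simps app_plus mult_tree_aut[symmetric] by (rule generate.eng)
qed

lemma tev_image: "tev ` carrier (free_group S) = generate tree_aut (generator ` S)"
proof
  show "tev ` carrier (free_group S) \<subseteq> generate tree_aut (generator ` S)"
    by (rule image_subsetI) (simp add: carrier_free_group tev_in_generate)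
  have "\<exists>w. w \<in> carrier (free_group S) \<and> tev w = f"
    if "f \<in> generate tree_aut (generator ` S)" for f
    using that
  proof induction
    case one
    show ?case by (rule exI[of _ "[]"]) (simp add: carrier_free_group one_tree_aut)
  next
    case (incl h)
    then obtain k where "k \<in> S" "h = generator k" by blast
    then show ?case
      by (intro exI[of _ "[(False, k)]"]) (simp add: app_tgen carrier_free_group reduced_Cons)
  next
    case (inv h)
    then obtain k where "k \<in> S" "h = generator k" by blast
    then show ?case
      by (intro exI[of _ "[(True, k)]"]) (simp add: app_minus_tgen carrier_free_group reduced_Cons)
  next
    case (eng h1 h2)
    then obtain u v where uv: "tev u = h1" "tev v = h2"
      "u \<in> carrier (free_group S)" "v \<in> carrier (free_group S)"
      by blast
    then have "snd ` set (u @ v) \<subseteq> S" by (simp add: carrier_free_group image_Un)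
    from reduce_in_carrier[OF this] show ?case
      by (intro exI[of _ "reduce (u @ v)"]) (simp add: uv mult_tree_aut)
  qed
  then show "generate tree_aut (generator ` S) \<subseteq> tev ` carrier (free_group S)" by blast
qed

lemma tev_hom: "tev ` carrier (free_group S) = G \<Longrightarrow> tev \<in> hom (free_group S) (tree_aut\<lparr>carrier := G\<rparr>)"
  by (rule homI) (auto simp: mult_free_group tree_aut_def)

lemma K_eq: "tev ` carrier (free_group {0, 1}) = K_subgroup"
  unfolding tev_image K_subgroup_def by (simp add: generator_def insert_commute)

lemma Gamma_eq: "tev ` carrier (free_group {0, 1, 2}) = Gamma_bar"
proof -
  interpret T: group "tree_aut :: (3 list \<Rightarrow> 3 list) monoid" by (rule group_tree_aut)
  have "generate tree_aut {tree_x, tree_y, tree_a} = generate tree_aut {tree_a, tree_s}"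
  proof
    have "{tree_x, tree_y, tree_a} \<subseteq> generate tree_aut {tree_a, tree_s}"
      unfolding tree_x_def tree_y_def by (auto intro: generate.intros)
    then show "generate tree_aut {tree_x, tree_y, tree_a} \<subseteq> generate tree_aut {tree_a, tree_s}"
      using subgroup_Gamma_bar unfolding Gamma_bar_def by (rule T.generate_subgroup_incl)
    have carrier: "{tree_x, tree_y, tree_a} \<subseteq> carrier tree_aut"
      by (simp add: tree_x_def tree_y_def tree_a_in_tree_aut tree_s_in_tree_aut)
    have "tree_s = tree_x \<otimes>\<^bsub>tree_aut\<^esub> tree_a"
      using tree_a_in_tree_aut tree_s_in_tree_aut by (simp add: tree_x_def T.m_assoc)
    moreover have "tree_x \<otimes>\<^bsub>tree_aut\<^esub> tree_a \<in> generate tree_aut {tree_x, tree_y, tree_a}"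
      by (intro generate.eng generate.incl) simp_all
    ultimately have "{tree_a, tree_s} \<subseteq> generate tree_aut {tree_x, tree_y, tree_a}"
      by (simp add: generate.incl)
    then show "generate tree_aut {tree_a, tree_s} \<subseteq> generate tree_aut {tree_x, tree_y, tree_a}"
      using T.generate_is_subgroup[OF carrier] by (rule T.generate_subgroup_incl)
  qed
  moreover have "generator ` {0, 1, 2} = {tree_x, tree_y, tree_a}" by (auto simp: generator_def)
  ultimately show ?thesis by (simp add: tev_image Gamma_bar_def)
qed

lemma relators_eq: "(\<Union>\<phi> \<in> endo_monoid {\<Phi>}. \<phi> ` reduce ` base_words) = relators"
  by (simp add: relators_def)

lemma one_restrict: "\<one>\<^bsub>tree_aut\<lparr>carrier := G\<rparr>\<^esub> = id"
  by (simp add: tree_aut_def)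

lemma finite_base_words: "finite base_words"
  by (simp add: base_words_def)

lemma K_finitely_L_presented: "finitely_L_presented (tree_aut\<lparr>carrier := K_subgroup\<rparr>)"
proof (rule finitely_L_presentedI[where S = "{0, 1}" and Q = "{}" and \<Psi> = "{\<Phi>}" and R = "reduce ` base_words" and h = tev])
  show "group (tree_aut\<lparr>carrier := K_subgroup\<rparr>)"
    using subgroup_K_subgroup group_tree_aut by (rule subgroup.subgroup_is_group)
  show "tev \<in> hom (free_group {0, 1}) (tree_aut\<lparr>carrier := K_subgroup\<rparr>)"
    using K_eq by (rule tev_hom)
  show "tev ` carrier (free_group {0, 1}) = carrier (tree_aut\<lparr>carrier := K_subgroup\<rparr>)"
    using K_eq by simp
  have "{w \<in> carrier (free_group {0, 1}). wev tgen w = 0} = normal_closure (free_group {0, 1}) relators"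
  proof
    show "{w \<in> carrier (free_group {0, 1}). wev tgen w = 0} \<subseteq> normal_closure (free_group {0, 1}) relators"
    proof safe
      fix w assume w: "w \<in> carrier (free_group {0, 1})" "wev tgen w = 0"
      then have "reduce w \<in> normal_closure (free_group {0, 1}) relators"
        by (intro trivial_word_in_normal_closure) (simp_all add: carrier_free_group)
      moreover have "reduce w = w" using w(1) by (simp add: carrier_free_group reduce_reduced)
      ultimately show "w \<in> normal_closure (free_group {0, 1}) relators" by simp
    qed
    show "normal_closure (free_group {0, 1}) relators \<subseteq> {w \<in> carrier (free_group {0, 1}). wev tgen w = 0}"
      using relators_letters_trivial by (intro normal_closure_minimal wev_kernel_normal) blast
  qed
  then show "{w \<in> carrier (free_group {0, 1}). tev w = \<one>\<^bsub>tree_aut\<lparr>carrier := K_subgroup\<rparr>\<^esub>}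
      = normal_closure (free_group {0, 1}) ({} \<union> (\<Union>\<phi>\<in>endo_monoid {\<Phi>}. \<phi> ` reduce ` base_words))"
    by (simp only: one_restrict app_eq_id_iff relators_eq Un_empty_left)
  show "L_presentation {0, 1} {} {\<Phi>} (reduce ` base_words)"
    using base_words_carrier \<Phi>_hom[of "{0, 1}"] by (simp add: L_presentation_def)
qed (simp_all add: finite_base_words)

section \<open>The L-presentation of \<open>Gamma_bar\<close>\<close>

text \<open>With 2 for a these say a^3 = 1, xa = ay (both are s), and yayx = a, which given the
  others means s^3 = 1. Read as conjugations: a^-1 x a = y and a^-1 y a = x^-1 y^-1.\<close>

definition rotation_words :: "nat letter list set" where
  "rotation_words = {[(False, 2), (False, 2), (False, 2)],
     [(False, 0), (False, 2), (True, 1), (True, 2)],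
     [(False, 1), (False, 2), (False, 1), (False, 0), (True, 2)]}"

definition a_pow :: "nat \<Rightarrow> nat letter list" where
  "a_pow j = replicate j (False, 2)"

text \<open>Conjugation by a^-1 acts on words in x and y as the substitution
  \<open>\<theta>\<close>, so powers of a can be collected on the left. The values \<open>c\<close>
  are arbitrary because both the abstract quotient and the tree action are needed.\<close>

lemma a_pow_decomposition:
  fixes c :: "nat \<Rightarrow> 'g::group_add"
  assumes rel: "\<And>r. r \<in> rotation_words \<Longrightarrow> wev c r = 0" and w: "snd ` set w \<subseteq> {0, 1, 2}"
  shows "\<exists>j<3. \<exists>u. snd ` set u \<subseteq> {0, 1} \<and> wev c w = wev c (a_pow j @ u)"
proof -
  note One_nat_def [simp del]
  define \<theta> :: "nat \<Rightarrow> nat letter list" where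
    "\<theta> k = (if k = 0 then [(False, 1)] else [(True, 0), (True, 1)])" for k
  have "wev c [(False, 2), (False, 2), (False, 2)] = 0"
    "wev c [(False, 0), (False, 2), (True, 1), (True, 2)] = 0"
    "wev c [(False, 1), (False, 2), (False, 1), (False, 0), (True, 2)] = 0"
    by (rule rel; simp add: rotation_words_def)+
  then have rels: "c 2 + (c 2 + c 2) = 0" "c 0 + (c 2 + (- c 1 + - c 2)) = 0"
    "c 1 + (c 2 + (c 1 + (c 0 + - c 2))) = 0" by simp_all
  have "c 0 + c 2 = (c 0 + (c 2 + (- c 1 + - c 2))) + (c 2 + c 1)" by (simp only: group_norm)
  then have x: "gconj (- c 2) (c 0) = c 1" unfolding rels by (simp add: gconj_def add.assoc)
  have "c 1 + c 2 = (c 1 + (c 2 + (c 1 + (c 0 + - c 2)))) + (c 2 + (- c 0 + - c 1))"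
    by (simp only: group_norm)
  then have y: "gconj (- c 2) (c 1) = - c 0 + - c 1" unfolding rels by (simp add: gconj_def add.assoc)
  have \<theta>: "gconj (- c 2) (wev c u) = wev c (wsub \<theta> u)" if "snd ` set u \<subseteq> {0, 1}" for u
    using that
  proof (induction u)
    case (Cons l u)
    have "gconj (- c 2) (c (snd l)) = wev c (\<theta> (snd l))"
      using Cons.prems x y by (auto simp: \<theta>_def)
    then show ?case using Cons by (simp add: conj_add conj_minus)
  qed simp
  have letters_\<theta>: "snd ` set (wsub \<theta> u) \<subseteq> {0, 1}" for u
  proof -
    have "snd ` set (\<theta> k) \<subseteq> {0, 1}" for k by (cases "k = 0") (auto simp: \<theta>_def)
    then show ?thesis unfolding letters_wsub by (rule UN_least)
  qed
  have move: "\<exists>u'. snd ` set u' \<subseteq> {0, 1} \<and> wev c u + wev c (a_pow j) = wev c (a_pow j) + wev c u'"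
    if "snd ` set u \<subseteq> {0, 1}" for u j
    using that
  proof (induction j arbitrary: u)
    case (Suc j)
    obtain u' where u': "snd ` set u' \<subseteq> {0, 1}"
      "wev c (wsub \<theta> u) + wev c (a_pow j) = wev c (a_pow j) + wev c u'"
      using Suc.IH[OF letters_\<theta>] by blast
    have pow: "wev c (a_pow (Suc j)) = c 2 + wev c (a_pow j)" by (simp add: a_pow_def)
    have "wev c u + wev c (a_pow (Suc j)) = c 2 + (gconj (- c 2) (wev c u) + wev c (a_pow j))"
      unfolding pow by (simp only: gconj_def group_norm)
    also have "\<dots> = wev c (a_pow (Suc j)) + wev c u'"
      unfolding \<theta>[OF Suc.prems] u'(2) pow by (simp only: add.assoc)
    finally have "wev c u + wev c (a_pow (Suc j)) = wev c (a_pow (Suc j)) + wev c u'" .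
    then show ?case using u'(1) by blast
  qed (auto simp: a_pow_def)
  show ?thesis
    using w
  proof (induction w)
    case Nil
    show ?case by (intro exI[of _ 0] conjI exI[of _ "[]"]) (simp_all add: a_pow_def)
  next
    case (Cons l w)
    then obtain j u where IH: "j < 3" "snd ` set u \<subseteq> {0, 1}" "wev c w = wev c (a_pow j @ u)" by auto
    show ?case
    proof (cases "snd l = 2")
      case True
      have m: "- c 2 = c 2 + c 2" using rels(1) by (rule minus_unique)
      have pow: "wev c (a_pow 0) = 0" "wev c (a_pow 1) = c 2" "wev c (a_pow 2) = c 2 + c 2"
        by (simp_all add: a_pow_def numeral_2_eq_2 One_nat_def)
      have l: "wev c [l] = (if fst l then - c 2 else c 2)" using True by simp
      consider "j = 0" | "j = 1" | "j = 2" using IH(1) by linarith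
      then have "\<exists>j'<3. wev c [l] + wev c (a_pow j) = wev c (a_pow j')"
      proof cases
        case 1
        show ?thesis
          unfolding l 1 by (rule exI[of _ "if fst l then 2 else 1"]) (simp only: pow m split: if_split, simp)
      next
        case 2
        show ?thesis
          unfolding l 2 by (rule exI[of _ "if fst l then 0 else 2"]) (simp only: pow split: if_split, simp)
      next
        case 3
        show ?thesis
          unfolding l 3 using rels(1)
          by (intro exI[of _ "if fst l then 1 else 0"]) (simp only: pow split: if_split, simp)
      qed
      then obtain j' where j': "j' < 3" "wev c [l] + wev c (a_pow j) = wev c (a_pow j')" by blast
      have "wev c (l # w) = wev c [l] + wev c (a_pow j) + wev c u" by (simp add: IH(3) add.assoc)
      then have "wev c (l # w) = wev c (a_pow j' @ u)" by (simp only: j'(2) wev_append)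
      then show ?thesis using j'(1) IH(2) by blast
    next
      case False
      then have "snd ` set [l] \<subseteq> {0, 1}" using Cons.prems by auto
      then obtain u' where u': "snd ` set u' \<subseteq> {0, 1}"
        "wev c [l] + wev c (a_pow j) = wev c (a_pow j) + wev c u'"
        using move by blast
      have "wev c (l # w) = wev c [l] + wev c (a_pow j) + wev c u" by (simp add: IH(3) add.assoc)
      then have "wev c (l # w) = wev c (a_pow j @ (u' @ u))"
        by (simp only: u'(2) wev_append add.assoc)
      moreover have "snd ` set (u' @ u) \<subseteq> {0, 1}" using u'(1) IH(2) by (simp add: image_Un)
      ultimately show ?thesis using IH(1) by blast
    qed
  qed
qed

lemma tev_a_pow: "tev (a_pow j) = rot (of_nat j)"
  by (induction j) (auto simp: a_pow_def app_tgen generator_def tree_a_eq fun_eq_iff algebra_simps)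

lemma rotation_words_trivial:
  assumes "r \<in> rotation_words"
  shows "wev tgen r = 0"
proof -
  note One_nat_def [simp del]
  have x: "tree_x (rot 1 \<tau>) = tree_s \<tau>" and y: "rot 1 (tree_y \<tau>) = tree_s \<tau>" for \<tau>
    by (simp_all add: tree_x_eq tree_y_eq numeral_3_eq_0)
  have a: "app (tgen 2) = rot 1" "app (tgen 0) = tree_x" "app (tgen 1) = tree_y"
    by (simp_all add: app_tgen generator_def tree_a_eq)
  have x_a: "tgen 0 + tgen 2 = tgen 2 + tgen 1"
    by (simp add: a x y fun_eq_iff flip: app_inject)
  have "tree_s (tree_s (tree_s \<tau>)) = \<tau>" for \<tau>
    by (induction \<tau>) (simp_all add: tree_a_eq numeral_3_eq_0)
  \<comment> \<open>The sum is s^3, with s written as ay, ay and xa.\<close>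
  then have "app (tgen 2 + tgen 1 + (tgen 2 + tgen 1) + (tgen 0 + tgen 2)) = id"
    by (simp add: a x y fun_eq_iff)
  then have s: "tgen 2 + tgen 1 + (tgen 2 + tgen 1) + (tgen 0 + tgen 2) = 0"
    by (simp only: app_eq_id_iff)
  have aaa: "tgen 2 + (tgen 2 + tgen 2) = 0"
    by (simp add: a fun_eq_iff numeral_3_eq_0 flip: app_eq_id_iff)
  have "tgen 1 + (tgen 2 + (tgen 1 + (tgen 0 + - tgen 2)))
      = - tgen 2 + (tgen 2 + tgen 1 + (tgen 2 + tgen 1) + (tgen 0 + tgen 2)) + - (tgen 2 + tgen 2)"
    by (simp only: group_norm)
  also have "\<dots> = - (tgen 2 + (tgen 2 + tgen 2))" unfolding s by (simp only: group_norm)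
  finally have "tgen 1 + (tgen 2 + (tgen 1 + (tgen 0 + - tgen 2))) = 0" by (simp only: aaa minus_zero)
  moreover have "tgen 0 + (tgen 2 + (- tgen 1 + - tgen 2)) = (tgen 0 + tgen 2) + - (tgen 2 + tgen 1)"
    by (simp only: group_norm)
  then have "tgen 0 + (tgen 2 + (- tgen 1 + - tgen 2)) = 0" by (simp only: x_a right_minus)
  ultimately show ?thesis using assms aaa by (auto simp: rotation_words_def)
qed

lemma rotation_words_carrier: "rotation_words \<subseteq> carrier (free_group {0, 1, 2})"
  by (auto simp: rotation_words_def carrier_free_group reduced_Cons inv_letter_def)

lemma free_group_mono: "S \<subseteq> S' \<Longrightarrow> carrier (free_group S) \<subseteq> carrier (free_group S')"
proof
  fix w assume "S \<subseteq> S'" "w \<in> carrier (free_group S)"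
  then show "w \<in> carrier (free_group S')" unfolding carrier_free_group by (metis order_trans)
qed

text \<open>Modulo the rotation words \<open>w\<close> becomes a^j u with \<open>u\<close> over x
  and y. Triviality makes \<open>u\<close> act as a rotation, which in K forces j = 0, and the
  presentation of K finishes.\<close>

lemma trivial_word_in_normal_closure_Gamma:
  assumes w: "w \<in> carrier (free_group {0, 1, 2})" "wev tgen w = 0"
  shows "w \<in> normal_closure (free_group {0, 1, 2}) (rotation_words \<union> relators)"
proof -
  let ?F = "free_group {0, 1, 2 :: nat}"
  define N where "N = normal_closure ?F (rotation_words \<union> relators)"
  have relators_carrier: "relators \<subseteq> carrier (free_group {0, 1})"
    using relators_letters_trivial by blast
  have carrier: "rotation_words \<union> relators \<subseteq> carrier ?F"
    using rotation_words_carrier order_trans[OF relators_carrier free_group_mono[of "{0, 1}" "{0, 1, 2}"]]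
    by simp
  then have N: "N \<lhd> ?F" unfolding N_def by (intro normal_closure_normal group_free_group)
  obtain c :: "nat \<Rightarrow> nat letter list set bijection"
    where c: "\<And>w. snd ` set w \<subseteq> {0, 1, 2} \<Longrightarrow> wev c w = 0 \<longleftrightarrow> reduce w \<in> N"
    using free_group_quotient_action[OF N] by metis
  have c': "wev c r = 0" if "r \<in> rotation_words \<union> relators" for r
  proof -
    have "r \<in> N" unfolding N_def using that normal_closure_subset by (rule rev_subsetD)
    moreover have "r \<in> carrier ?F" using that carrier by blast
    then have "reduced r" "snd ` set r \<subseteq> {0, 1, 2}" by (simp_all only: carrier_free_group)
    ultimately show ?thesis using c by (simp add: reduce_reduced)
  qed
  have "wev c r = 0" if "r \<in> rotation_words" for r using c' that by simp
  moreover have letters: "snd ` set w \<subseteq> {0, 1, 2}" using w(1) by (simp add: carrier_free_group)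
  ultimately obtain j u where ju: "j < 3" "snd ` set u \<subseteq> {0, 1}" "wev c w = wev c (a_pow j @ u)"
    using a_pow_decomposition[of c w] by blast
  have "wev c (w @ winv (a_pow j @ u)) = 0" by (simp only: wev_append[of c w] wev_winv ju(3) right_minus)
  moreover have "snd ` set (w @ winv (a_pow j @ u)) \<subseteq> {0, 1, 2}"
    using letters ju(2) unfolding set_append image_Un letters_winv by (auto simp: a_pow_def)
  ultimately have "reduce (w @ winv (a_pow j @ u)) \<in> N" using c by blast
  moreover have "N \<subseteq> {w \<in> carrier ?F. wev tgen w = 0}"
    unfolding N_def
    using carrier rotation_words_trivial relators_letters_trivial
    by (intro normal_closure_minimal wev_kernel_normal) blast
  ultimately have "wev tgen (reduce (w @ winv (a_pow j @ u))) = 0" by blast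
  then have "wev tgen (a_pow j) + wev tgen u = 0" using w(2) by simp
  then have u: "wev tgen u = - wev tgen (a_pow j)" by (rule minus_unique[symmetric])
  have "tev u = rot (- of_nat j)"
  proof
    show "tev u \<tau> = rot (- of_nat j) \<tau>" for \<tau>
      unfolding u by (rule app_minus_eqI) (simp add: tev_a_pow)
  qed
  then have "- of_nat j = (0 :: 3)" by (rule rot_not_in_K[OF ju(2)])
  moreover have "j = 0 \<or> j = 1 \<or> j = 2" using ju(1) by linarith
  ultimately have "j = 0" by auto
  then have "wev tgen u = 0" using u by (simp add: a_pow_def)
  then have "reduce u \<in> normal_closure (free_group {0, 1}) relators"
    using ju(2) by (intro trivial_word_in_normal_closure)
  moreover have "normal_closure (free_group {0, 1}) relators \<subseteq> {w \<in> carrier (free_group {0, 1}). wev c w = 0}"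
    using relators_carrier c' by (intro normal_closure_minimal wev_kernel_normal) blast
  ultimately have "wev c (reduce u) = 0" by blast
  then have "wev c w = 0" using ju(3) \<open>j = 0\<close> by (simp add: a_pow_def)
  then show ?thesis
    using c[OF letters] w(1) by (simp add: N_def carrier_free_group reduce_reduced)
qed

lemma Gamma_finitely_L_presented: "finitely_L_presented (tree_aut\<lparr>carrier := Gamma_bar\<rparr>)"
proof (rule finitely_L_presentedI[where S = "{0, 1, 2}" and Q = rotation_words and \<Psi> = "{\<Phi>}" and R = "reduce ` base_words" and h = tev])
  show "group (tree_aut\<lparr>carrier := Gamma_bar\<rparr>)"
    using subgroup_Gamma_bar group_tree_aut by (rule subgroup.subgroup_is_group)
  show "tev \<in> hom (free_group {0, 1, 2}) (tree_aut\<lparr>carrier := Gamma_bar\<rparr>)"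
    using Gamma_eq by (rule tev_hom)
  show "tev ` carrier (free_group {0, 1, 2}) = carrier (tree_aut\<lparr>carrier := Gamma_bar\<rparr>)"
    using Gamma_eq by simp
  have mono: "carrier (free_group {0, 1}) \<subseteq> carrier (free_group {0, 1, 2 :: nat})"
    by (rule free_group_mono) simp
  have "{w \<in> carrier (free_group {0, 1, 2}). wev tgen w = 0}
      = normal_closure (free_group {0, 1, 2}) (rotation_words \<union> relators)"
  proof
    show "{w \<in> carrier (free_group {0, 1, 2}). wev tgen w = 0}
        \<subseteq> normal_closure (free_group {0, 1, 2}) (rotation_words \<union> relators)"
    proof safe
      fix w assume "w \<in> carrier (free_group {0, 1, 2})" "wev tgen w = 0"
      then show "w \<in> normal_closure (free_group {0, 1, 2}) (rotation_words \<union> relators)"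
        by (rule trivial_word_in_normal_closure_Gamma)
    qed
    show "normal_closure (free_group {0, 1, 2}) (rotation_words \<union> relators)
        \<subseteq> {w \<in> carrier (free_group {0, 1, 2}). wev tgen w = 0}"
      using relators_letters_trivial mono rotation_words_carrier rotation_words_trivial
      by (intro normal_closure_minimal wev_kernel_normal) blast
  qed
  then show "{w \<in> carrier (free_group {0, 1, 2}). tev w = \<one>\<^bsub>tree_aut\<lparr>carrier := Gamma_bar\<rparr>\<^esub>}
      = normal_closure (free_group {0, 1, 2})
          (rotation_words \<union> (\<Union>\<phi>\<in>endo_monoid {\<Phi>}. \<phi> ` reduce ` base_words))"
    by (simp only: one_restrict app_eq_id_iff relators_eq)
  show "L_presentation {0, 1, 2} rotation_words {\<Phi>} (reduce ` base_words)"
    using order_trans[OF base_words_carrier mono] \<Phi>_hom[of "{0, 1, 2}"] rotation_words_carrier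
    by (simp add: L_presentation_def)
qed (simp_all add: finite_base_words rotation_words_def)

section \<open>Rigid stabilizers\<close>

text \<open>
  The exponent sums of the three sections of a word fixing the first level satisfy two linear
  relations, so that a section is determined up to the commutator subgroup by the other two.
\<close>

lemma exponents_sect:
  assumes "snd ` set w \<subseteq> {0, 1}"
  shows "ex (sect 1 w) - ex (sect 0 w) + ey (sect 0 w) - ey (sect 2 w) = (if dg w = 0 then 0 else 1)"
    "ex (sect 2 w) - ex (sect 0 w) + ey (sect 1 w) - ey (sect 2 w) = (if dg w = 2 then 1 else 0)"
proof -
  have "ex (sect 1 w) - ex (sect 0 w) + ey (sect 0 w) - ey (sect 2 w) = (if dg w = 0 then 0 else 1) \<and>
    ex (sect 2 w) - ex (sect 0 w) + ey (sect 1 w) - ey (sect 2 w) = (if dg w = 2 then 1 else 0)"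
    using assms
  proof (induction w)
    case (Cons l w)
    then show ?case
      using exhaust_3[of "dg w"] by (cases l) (auto simp: active_cases numeral_3_eq_0)
  qed simp
  then show "ex (sect 1 w) - ex (sect 0 w) + ey (sect 0 w) - ey (sect 2 w) = (if dg w = 0 then 0 else 1)"
    "ex (sect 2 w) - ex (sect 0 w) + ey (sect 1 w) - ey (sect 2 w) = (if dg w = 2 then 1 else 0)"
    by simp_all
qed

text \<open>The kernel of the homomorphism from K onto the integers induced by \<open>ex\<close>,
  well defined by \<open>trivial_word_exponents\<close>.\<close>

definition ex_kernel :: "(3 list \<Rightarrow> 3 list) set" where
  "ex_kernel = {tev w | w. snd ` set w \<subseteq> {0, 1} \<and> ex w = 0}"

lemma subgroup_ex_kernel: "subgroup ex_kernel tree_aut"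
proof -
  interpret T: group "tree_aut :: (3 list \<Rightarrow> 3 list) monoid" by (rule group_tree_aut)
  have tev: "tev w \<in> carrier tree_aut" for w
    using tev_in_generate[of w UNIV] T.generate_in_carrier[of "generator ` UNIV"] generator_in_tree_aut
    by blast
  show ?thesis
  proof (rule T.subgroupI)
    show "ex_kernel \<subseteq> carrier tree_aut" using tev by (auto simp: ex_kernel_def)
    have "tev [] \<in> ex_kernel" unfolding ex_kernel_def by (intro CollectI exI[of _ "[]"]) simp
    then show "ex_kernel \<noteq> {}" by blast
    fix g assume "g \<in> ex_kernel"
    then obtain u where u: "g = tev u" "snd ` set u \<subseteq> {0, 1}" "ex u = 0" by (auto simp: ex_kernel_def)
    have "inv\<^bsub>tree_aut\<^esub> g = tev (winv u)" using tev by (simp add: u(1) inv_tree_aut app_minus)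
    then show "inv\<^bsub>tree_aut\<^esub> g \<in> ex_kernel"
      unfolding ex_kernel_def using u by (intro CollectI exI[of _ "winv u"]) simp
    fix h assume "h \<in> ex_kernel"
    then obtain v where v: "h = tev v" "snd ` set v \<subseteq> {0, 1}" "ex v = 0" by (auto simp: ex_kernel_def)
    have "g \<otimes>\<^bsub>tree_aut\<^esub> h = tev (u @ v)" by (simp add: u(1) v(1) mult_tree_aut)
    then show "g \<otimes>\<^bsub>tree_aut\<^esub> h \<in> ex_kernel"
      unfolding ex_kernel_def using u v by (intro CollectI exI[of _ "u @ v"]) (simp add: image_Un)
  qed
qed

text \<open>Write the element as a^j u. Fixing the subtrees at the two vertices other than
  \<open>i\<close> makes those sections of \<open>u\<close> act as rotations, hence trivially; so j
  is 0 modulo 3 and their exponent sums vanish.\<close>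

lemma rist_Gamma_subset: "rist Gamma_bar [i] \<subseteq> ex_kernel"
proof
  fix g assume g: "g \<in> rist Gamma_bar [i]"
  then have "g \<in> Gamma_bar" by (simp add: rist_def)
  then obtain w where w: "w \<in> carrier (free_group {0, 1, 2})" "g = tev w"
    unfolding Gamma_eq[symmetric] by blast
  obtain j u where ju: "snd ` set u \<subseteq> {0, 1}" "wev tgen w = wev tgen (a_pow j @ u)"
    using a_pow_decomposition[of tgen w] rotation_words_trivial w(1) by (auto simp: carrier_free_group)
  have g_eq: "g \<tau> = rot (of_nat j) (tev u \<tau>)" for \<tau>
    by (simp add: w(2) ju(2) tev_a_pow)
  have fix_g: "g (k # \<tau>) = k # \<tau>" if "k \<noteq> i" for k \<tau>
  proof -
    have "\<not> prefix [i] (k # \<tau>)" using that by simp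
    then show ?thesis using g by (auto simp: rist_def vertex_stab_def)
  qed
  have *: "of_nat j = dg u" "tev (sect k u) = rot (- dg u)" if k: "k \<noteq> i" for k
  proof -
    have eq: "(k - dg u + of_nat j) # rot (dg u - k) (tev (sect k u) (rot k \<tau>)) = k # \<tau>" for \<tau>
      using fix_g[OF k, of \<tau>] by (simp add: g_eq tev_Cons[OF ju(1)])
    then show "of_nat j = dg u" by (simp add: algebra_simps)
    show "tev (sect k u) = rot (- dg u)"
    proof
      fix \<tau>
      have "rot (dg u - k) (tev (sect k u) \<tau>) = rot (- k) \<tau>" using eq[of "rot (- k) \<tau>"] by simp
      then have "rot (k - dg u) (rot (dg u - k) (tev (sect k u) \<tau>)) = rot (k - dg u) (rot (- k) \<tau>)"
        by simp
      then show "tev (sect k u) \<tau> = rot (- dg u) \<tau>" by simp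
    qed
  qed
  have letters: "snd ` set (sect k u) \<subseteq> {0, 1}" for k using letters_sect ju(1) by (rule order_trans)
  obtain k0 :: 3 where "k0 \<noteq> i" by (metis zero_neq_one)
  then have "- dg u = 0" using rot_not_in_K[OF letters] *(2) by blast
  then have dg: "dg u = 0" by simp
  have exey: "ex (sect k u) = 0" "ey (sect k u) = 0" if "k \<noteq> i" for k
  proof -
    have "tev (sect k u) = id" using *(2)[OF that] dg by (simp add: fun_eq_iff)
    then have "wev tgen (sect k u) = 0" by (simp only: app_eq_id_iff)
    then show "ex (sect k u) = 0" "ey (sect k u) = 0" using trivial_word_exponents[OF letters] by blast+
  qed
  consider "i = 0" | "i = 1" | "i = 2" using exhaust_3 by blast
  \<comment> \<open>Whichever vertex \<open>i\<close> is, the two linear relations then annihilate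
    \<open>ex\<close> of the remaining section.\<close>
  then have "ex u = 0"
  proof cases
    case 1
    then show ?thesis using exponents_sect[OF ju(1)] ex_sect[of u] dg exey[of 1] exey[of 2] by simp
  next
    case 2
    then show ?thesis using exponents_sect[OF ju(1)] ex_sect[of u] dg exey[of 0] exey[of 2] by simp
  next
    case 3
    then show ?thesis using exponents_sect[OF ju(1)] ex_sect[of u] dg exey[of 0] exey[of 1] by simp
  qed
  moreover have "g = tev u" using *(1)[OF \<open>k0 \<noteq> i\<close>] dg by (simp add: fun_eq_iff g_eq)
  ultimately show "g \<in> ex_kernel" using ju(1) by (auto simp: ex_kernel_def)
qed

text \<open>The powers of x lie in different cosets of the first rigid level stabilizer, since
  \<open>ex\<close> is n on x^n and 0 on that stabilizer.\<close>

lemma not_branch_group: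
  assumes G: "subgroup G tree_aut" "tree_x \<in> G" "G \<subseteq> Gamma_bar"
  shows "\<not> branch_group G"
proof
  assume "branch_group G"
  interpret T: group "tree_aut :: (3 list \<Rightarrow> 3 list) monoid" by (rule group_tree_aut)
  let ?G = "tree_aut\<lparr>carrier := G\<rparr>" and ?H = "rist_level G 1"
  interpret G: subgroup G tree_aut by (rule G(1))
  have "rist G [i] \<subseteq> ex_kernel" for i
    using rist_Gamma_subset[of i] G(3) by (auto simp: rist_def vertex_stab_def)
  moreover have "\<exists>i. \<sigma> = [i]" if "length \<sigma> = 1" for \<sigma> :: "3 list"
    using that by (cases \<sigma>) auto
  ultimately have "(\<Union>\<sigma> \<in> {\<sigma>. length \<sigma> = 1}. rist G \<sigma>) \<subseteq> ex_kernel" by force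
  then have H: "?H \<subseteq> ex_kernel"
    unfolding rist_level_def using subgroup_ex_kernel by (rule T.generate_subgroup_incl)
  have one: "id \<in> ?H"
    unfolding rist_level_def one_tree_aut[symmetric] by (rule generate.one)
  define X where "X n = replicate n (False, 0 :: nat)" for n
  have x_G: "tev (X n) \<in> G" for n
  proof (induction n)
    case 0
    have "tev (X 0) = \<one>\<^bsub>tree_aut\<^esub>" by (simp add: X_def one_tree_aut)
    then show ?case using G.one_closed by simp
  next
    case (Suc n)
    have "tev (X (Suc n)) = tree_x \<otimes>\<^bsub>tree_aut\<^esub> tev (X n)"
      by (simp add: X_def mult_tree_aut app_tgen generator_def)
    then show ?case using G.m_closed[OF G(2) Suc] by simp
  qed
  define C where "C n = ?H #>\<^bsub>?G\<^esub> tev (X n)" for n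
  have "inj C"
  proof (rule injI)
    fix m n assume "C m = C n"
    have "tev (X m) \<in> C m"
      unfolding C_def r_coset_def using one by (auto intro!: bexI[of _ id] simp: mult_tree_aut)
    then have "tev (X m) \<in> C n" using \<open>C m = C n\<close> by simp
    then obtain h where "h \<in> ?H" "tev (X m) = h \<circ> tev (X n)"
      by (auto simp: C_def r_coset_def mult_tree_aut)
    then obtain w where w: "snd ` set w \<subseteq> {0, 1}" "ex w = 0" "tev (X m) = tev w \<circ> tev (X n)"
      using H by (auto simp: ex_kernel_def)
    have "tev (X m) = tev (w @ X n)" using w(3) by simp
    then have "wev tgen (X m) = wev tgen (w @ X n)" by (simp only: app_inject)
    then have "wev tgen (X m @ winv (w @ X n)) = 0" by (simp only: wev_append[of _ "X m"] wev_winv right_minus)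
    moreover have X: "snd ` set (X k) \<subseteq> {0, 1}" for k by (auto simp: X_def)
    then have "snd ` set (X m @ winv (w @ X n)) \<subseteq> {0, 1}"
      using w(1) unfolding set_append image_Un letters_winv by simp
    ultimately have "ex (X m @ winv (w @ X n)) = 0" by (intro trivial_word_exponents)
    moreover have "ex (X k) = int k" for k by (induction k) (simp_all add: X_def)
    ultimately show "m = n" using w(2) by simp
  qed
  moreover have "range C \<subseteq> rcosets\<^bsub>?G\<^esub> ?H"
    using x_G by (auto simp: C_def RCOSETS_def)
  moreover have "finite (rcosets\<^bsub>?G\<^esub> ?H)"
    using \<open>branch_group G\<close> by (simp add: branch_group_def)
  ultimately show False using finite_subset infinite_UNIV_nat finite_imageD by blast
qed

lemma tree_x_in_K: "tree_x \<in> K_subgroup"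
  unfolding K_subgroup_def by (rule generate.incl) simp

lemma K_subset_Gamma: "K_subgroup \<subseteq> Gamma_bar"
  unfolding K_eq[symmetric] Gamma_eq[symmetric] by (intro image_mono free_group_mono) simp

theorem theorem4p8:
  shows "\<not> branch_group K_subgroup \<and> \<not> branch_group Gamma_bar \<and>
         finitely_L_presented (tree_aut\<lparr>carrier := K_subgroup\<rparr>) \<and>
         finitely_L_presented (tree_aut\<lparr>carrier := Gamma_bar\<rparr>)"
  using not_branch_group[OF subgroup_K_subgroup tree_x_in_K K_subset_Gamma]
    not_branch_group[OF subgroup_Gamma_bar subsetD[OF K_subset_Gamma tree_x_in_K] order_refl]
    K_finitely_L_presented Gamma_finitely_L_presented
  by blast

end
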